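(* Let $\mathcal G^1$ be the class of all minors of the graphs $k\cdot K_3$, $k\ge 1$; let $\mathcal G^2$ be the class of all minors of the stars $K_{1,k}$, $k\ge 1$; and let $\mathcal G^3$ be the class of all minors of the paths $P_k$, $k\ge 1$. Then $\mathrm{cobs}(\mathbb C_{<1})=\{\mathcal G^1,\mathcal G^2,\mathcal G^3\}$.
   Context: Graphs are finite, without loops or multiple edges, and considered up to isomorphism. All graph classes considered are minor-closed and proper (a class is proper if it does not contain all graphs). For a graph class $\mathcal G$ let $\mathrm{ex}(\mathcal G,n)=\max\{|E(G)| : G\in\mathcal G,\ |V(G)|=n\}$. The limiting density of an infinite class is $\delta(\mathcal G)=\lim_{n\to\infty}\mathrm{ex}(\mathcal G,n)/n$; if $\mathcal G$ is finite then $\delta(\mathcal G)=-\infty$. $\mathbb C_{<1}$ is the set of all minor-closed graph classes $\mathcal G$ with $\delta(\mathcal G)<1$. For a set $\mathbb C$ of minor-closed classes, $\mathrm{cobs}(\mathbb C)$ is the set of all $\subseteq$-minimal minor-closed graph classes that do not belong to $\mathbb C$. $k\cdot H$ is the disjoint union of $k$ copies of $H$; $P_k$ is the path on $k$ vertices. *)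

theory Defs
  imports "HOL-Library.Extended_Real" "HOL-Library.Nat_Bijection"
begin

text \<open>A finite simple graph is a pair of a vertex set and a set of 2-element edges.  Since every
  finite graph has an isomorphic copy with vertices in \<open>nat\<close>, a graph class (a set of
  isomorphism types) is represented by an isomorphism-closed set of graphs on \<open>nat\<close>.
  The graph without vertices is admitted.\<close>

type_synonym graph = "nat set \<times> nat set set"

abbreviation verts :: "graph \<Rightarrow> nat set" where "verts \<equiv> fst"
abbreviation edges :: "graph \<Rightarrow> nat set set" where "edges \<equiv> snd"

definition is_graph :: "graph \<Rightarrow> bool" where
  "is_graph G \<longleftrightarrow> finite (verts G) \<and> (\<forall>e\<in>edges G. e \<subseteq> verts G \<and> card e = 2)"

definition graph_iso :: "(graph \<times> graph) set" where
  "graph_iso = {(G, H). is_graph G \<and> is_graph H \<and>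
     (\<exists>f. bij_betw f (verts G) (verts H) \<and> edges H = (\<lambda>e. f ` e) ` edges G)}"

definition connected_in :: "graph \<Rightarrow> nat set \<Rightarrow> bool" where
  "connected_in G S \<longleftrightarrow> S \<noteq> {} \<and> S \<subseteq> verts G \<and>
     (\<forall>u\<in>S. \<forall>v\<in>S. (u, v) \<in> {(x, y). x \<in> S \<and> y \<in> S \<and> {x, y} \<in> edges G}\<^sup>*)"

text \<open>\<open>H\<close> is a minor of \<open>G\<close>: the sets \<open>B x\<close> are the branch sets, which are contracted to the
  vertices \<open>x\<close> of \<open>H\<close>.  The relation contains isomorphism.\<close>

definition is_minor :: "graph \<Rightarrow> graph \<Rightarrow> bool" where
  "is_minor H G \<longleftrightarrow> (\<exists>B :: nat \<Rightarrow> nat set.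
     (\<forall>x\<in>verts H. connected_in G (B x)) \<and>
     (\<forall>x\<in>verts H. \<forall>y\<in>verts H. x \<noteq> y \<longrightarrow> B x \<inter> B y = {}) \<and>
     (\<forall>x y. {x, y} \<in> edges H \<longrightarrow> (\<exists>u\<in>B x. \<exists>v\<in>B y. {u, v} \<in> edges G)))"

text \<open>Closure under minors includes closure under isomorphism.\<close>

definition minor_closed_class :: "graph set \<Rightarrow> bool" where
  "minor_closed_class \<G> \<longleftrightarrow> \<G> \<subseteq> {G. is_graph G} \<and>
     (\<forall>G\<in>\<G>. \<forall>H. is_graph H \<and> is_minor H G \<longrightarrow> H \<in> \<G>)"

definition proper_class :: "graph set \<Rightarrow> bool" where
  "proper_class \<G> \<longleftrightarrow> \<G> \<noteq> {G. is_graph G}"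

text \<open>The maximum is over a finite set, and it is nonempty for every \<open>n\<close> if \<open>\<G>\<close> is an infinite
  minor-closed class, the only case in which \<open>ex\<close> is used below.\<close>

definition ex :: "graph set \<Rightarrow> nat \<Rightarrow> nat" where
  "ex \<G> n = Max {card (edges G) | G. G \<in> \<G> \<and> card (verts G) = n}"

text \<open>Finiteness of a class refers to the number of isomorphism types in it.\<close>

definition limiting_density :: "graph set \<Rightarrow> ereal" where
  "limiting_density \<G> =
     (if finite (\<G> // graph_iso) then - \<infinity>
      else lim (\<lambda>n. ereal (real (ex \<G> n) / real n)))"

definition C_less_1 :: "graph set set" where
  "C_less_1 = {\<G>. minor_closed_class \<G> \<and> proper_class \<G> \<and> limiting_density \<G> < 1}"

definition cobs :: "graph set set \<Rightarrow> graph set set" where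
  "cobs \<C> = {\<G>. minor_closed_class \<G> \<and> proper_class \<G> \<and> \<G> \<notin> \<C> \<and>
     (\<forall>\<H>. minor_closed_class \<H> \<and> proper_class \<H> \<and> \<H> \<notin> \<C> \<and> \<H> \<subseteq> \<G> \<longrightarrow> \<H> = \<G>)}"

definition complete_graph :: "nat \<Rightarrow> graph" where
  "complete_graph n = ({..<n}, {e. e \<subseteq> {..<n} \<and> card e = 2})"

definition complete_bipartite :: "nat \<Rightarrow> nat \<Rightarrow> graph" where
  "complete_bipartite m n = ({..<m + n}, {{i, j} | i j. i < m \<and> m \<le> j \<and> j < m + n})"

definition path_graph :: "nat \<Rightarrow> graph" where
  "path_graph k = ({..<k}, {{i, Suc i} | i. Suc i < k})"

text \<open>\<open>k \<cdot> H\<close>; the vertex \<open>v\<close> of the \<open>i\<close>-th copy is \<open>prod_encode (i, v)\<close>.\<close>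

definition copies :: "nat \<Rightarrow> graph \<Rightarrow> graph" where
  "copies k H = (prod_encode ` ({..<k} \<times> verts H),
     {(\<lambda>v. prod_encode (i, v)) ` e | i e. i < k \<and> e \<in> edges H})"

definition minors_of :: "(nat \<Rightarrow> graph) \<Rightarrow> graph set" where
  "minors_of F = {H. is_graph H \<and> (\<exists>k\<ge>1. is_minor H (F k))}"

definition class_G1 :: "graph set" where
  "class_G1 = minors_of (\<lambda>k. copies k (complete_graph 3))"

definition class_G2 :: "graph set" where
  "class_G2 = minors_of (\<lambda>k. complete_bipartite 1 k)"

definition class_G3 :: "graph set" where
  "class_G3 = minors_of (\<lambda>k. path_graph k)"

end

theory Submission imports Defs begin

text \<open>
  If a class omits some \<open>k \<cdot> K\<^sub>3\<close>, some star and some path, then its members have bounded maximal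
  degree and no long paths, so their components have bounded size; and a component with at least
  as many edges as vertices contains a \<open>K\<^sub>3\<close> minor, so all but boundedly many components are trees.
  Let \<open>s\<close> be the largest number such that members of the class can have arbitrarily many components
  with at least \<open>s\<close> vertices.  Then, up to a bounded error, the densest graphs consist of trees
  on \<open>s\<close> vertices, and the limiting density is \<open>1 - 1/s\<close>.  The three obstructions themselves have
  density 1 and are pairwise incomparable.
\<close>

section \<open>Connected sets and minors\<close>

text \<open>No general convergence theorem for minor-closed classes is used: bounds
  \<open>a * n - c\<close> and \<open>a * n + c\<close> on the maximal number of edges give the
  existence of the limit and its value together. The value 1 - 1/s reflects that a tree on t
  vertices has t - 1 edges and that t - 1 \<le> (1 - 1/s) t exactly when t \<le> s. Components with
  more than s vertices or with a triangle minor are the exceptions; their number is bounded by the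
  maximality of s and by the omitted triangle copies, and their size by the omitted star and path,
  so \<open>c\<close> absorbs them. For the lower bound, large components need be neither trees nor
  of size s: a connected set can be trimmed to s vertices, and connectedness alone yields s - 1
  edges. Acyclicity and spanning trees never appear. Connectedness is handled through cuts, and a
  finite connected set is built up one vertex at a time; counting the edges gained in each step
  gives both tree bounds.\<close>

lemma connected_in_iff_cut:
  "connected_in G S \<longleftrightarrow> S \<noteq> {} \<and> S \<subseteq> verts G \<and>
     (\<forall>T. T \<noteq> {} \<longrightarrow> T \<subset> S \<longrightarrow> (\<exists>u\<in>T. \<exists>v\<in>S - T. {u, v} \<in> edges G))"
  (is "_ \<longleftrightarrow> ?R")
proof
  let ?r = "{(x, y). x \<in> S \<and> y \<in> S \<and> {x, y} \<in> edges G}"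
  assume c: "connected_in G S"
  \<comment> \<open>If no edge of \<open>G\<close> led from \<open>T\<close> to
    \<open>S - T\<close>, a walk in \<open>S\<close> starting in \<open>T\<close> could never leave
    \<open>T\<close>.\<close>
  have "\<exists>u\<in>T. \<exists>v\<in>S - T. {u, v} \<in> edges G" if T: "T \<noteq> {}" "T \<subset> S" for T
  proof (rule ccontr)
    assume n: "\<not> ?thesis"
    obtain u v where uv: "u \<in> T" "v \<in> S" "v \<notin> T" using T by blast
    then have "(u, v) \<in> ?r\<^sup>*" using c T unfolding connected_in_def by blast
    then have "v \<in> T"
      by (induction rule: rtrancl_induct) (use uv n in auto)
    with uv show False by blast
  qed
  then show ?R using c unfolding connected_in_def by blast
next
  let ?r = "{(x, y). x \<in> S \<and> y \<in> S \<and> {x, y} \<in> edges G}"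
  assume R: ?R
  have "(u, v) \<in> ?r\<^sup>*" if "u \<in> S" "v \<in> S" for u v
  proof (rule ccontr)
    assume n: "(u, v) \<notin> ?r\<^sup>*"
    \<comment> \<open>The set of vertices reachable from \<open>u\<close> inside \<open>S\<close>
      has no outgoing edge, so the cut condition forces it to be all of \<open>S\<close>.\<close>
    let ?T = "{w \<in> S. (u, w) \<in> ?r\<^sup>*}"
    have "?T \<noteq> {}" "?T \<subset> S" using that n by auto
    then obtain w x where "w \<in> ?T" "x \<in> S - ?T" "{w, x} \<in> edges G" using R by meson
    then show False by (auto intro: rtrancl_into_rtrancl)
  qed
  then show "connected_in G S" using R unfolding connected_in_def by blast
qed

lemma connected_in_cut:
  assumes "connected_in G S" "T \<noteq> {}" "T \<subseteq> S" "T \<noteq> S"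
  obtains u v where "u \<in> T" "v \<in> S - T" "{u, v} \<in> edges G"
  using assms unfolding connected_in_iff_cut by blast

lemma connected_in_nonempty: "connected_in G S \<Longrightarrow> S \<noteq> {}"
  and connected_in_verts: "connected_in G S \<Longrightarrow> S \<subseteq> verts G"
  unfolding connected_in_def by auto

lemma connected_in_singleton: "v \<in> verts G \<Longrightarrow> connected_in G {v}"
  unfolding connected_in_def by auto

text \<open>A cut of the union either splits \<open>A\<close> or \<open>B\<close>, and connectedness
  of that set gives the edge, or it has \<open>A\<close> and \<open>B\<close> on different sides,
  and then the edge between \<open>u\<close> and \<open>v\<close> crosses it.\<close>

lemma connected_in_Un:
  assumes A: "connected_in G A" and B: "connected_in G B" and "u \<in> A" "v \<in> B" "{u, v} \<in> edges G"
  shows "connected_in G (A \<union> B)"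
  unfolding connected_in_iff_cut
proof (intro conjI allI impI)
  show "A \<union> B \<noteq> {}" "A \<union> B \<subseteq> verts G" using assms connected_in_verts by auto
  fix T assume T: "T \<noteq> {}" "T \<subset> A \<union> B"
  have vu: "{v, u} \<in> edges G" using assms by (simp add: insert_commute)
  show "\<exists>u\<in>T. \<exists>v\<in>A \<union> B - T. {u, v} \<in> edges G"
  proof (cases "(A \<inter> T = {} \<or> A \<subseteq> T) \<and> (B \<inter> T = {} \<or> B \<subseteq> T)")
    case True
    then have "(A \<inter> T = {} \<and> B \<subseteq> T) \<or> (A \<subseteq> T \<and> B \<inter> T = {})" using T by blast
    then show ?thesis using assms vu by blast
  next
    case False
    then consider "A \<inter> T \<noteq> {}" "A \<inter> T \<noteq> A" | "B \<inter> T \<noteq> {}" "B \<inter> T \<noteq> B" by blast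
    then show ?thesis
    proof cases
      case 1 then show ?thesis using connected_in_cut[OF A 1(1)] by (metis Diff_iff Int_iff Int_lower1 UnCI)
    next
      case 2 then show ?thesis using connected_in_cut[OF B 2(1)] by (metis Diff_iff Int_iff Int_lower1 UnCI)
    qed
  qed
qed

text \<open>Wherever the cut puts the common vertex \<open>v\<close>, some member of
  \<open>F\<close> reaches the other side and is therefore split.\<close>

lemma connected_in_Union_common:
  assumes "F \<noteq> {}" "\<And>A. A \<in> F \<Longrightarrow> connected_in G A \<and> v \<in> A"
  shows "connected_in G (\<Union>F)"
  unfolding connected_in_iff_cut
proof (intro conjI allI impI)
  show "\<Union>F \<noteq> {}" "\<Union>F \<subseteq> verts G" using assms connected_in_verts by blast+
  fix T assume T: "T \<noteq> {}" "T \<subset> \<Union>F"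
  have "\<exists>A\<in>F. A \<inter> T \<noteq> {} \<and> A \<inter> T \<noteq> A"
  proof (cases "v \<in> T")
    case True
    obtain w A where "w \<in> A" "A \<in> F" "w \<notin> T" using T by blast
    then show ?thesis using True assms(2)[of A] by blast
  next
    case False
    obtain w A where "w \<in> A" "A \<in> F" "w \<in> T" using T by blast
    then show ?thesis using False assms(2)[of A] by blast
  qed
  then obtain A where A: "A \<in> F" "A \<inter> T \<noteq> {}" "A \<inter> T \<noteq> A" by blast
  then show "\<exists>u\<in>T. \<exists>v\<in>\<Union>F - T. {u, v} \<in> edges G"
    using connected_in_cut[of G A "A \<inter> T"] assms(2)[of A]
    by (metis Diff_iff Int_iff Int_lower1 UnionI)
qed

text \<open>Blowing vertices up to branch sets preserves connectedness, which is what composing two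
  minor models requires. A cut that splits no branch set comes from a cut of \<open>S\<close>, and a
  crossing edge there lifts to one in \<open>G'\<close>.\<close>

lemma connected_in_UN_minor:
  assumes S: "connected_in G S"
    and B: "\<And>y. y \<in> verts G \<Longrightarrow> connected_in G' (B y)"
    and E: "\<And>x y. {x, y} \<in> edges G \<Longrightarrow> \<exists>u\<in>B x. \<exists>v\<in>B y. {u, v} \<in> edges G'"
  shows "connected_in G' (\<Union>y\<in>S. B y)"
  unfolding connected_in_iff_cut
proof (intro conjI allI impI)
  have SV: "S \<noteq> {}" "S \<subseteq> verts G" using S connected_in_nonempty connected_in_verts by auto
  have By: "B y \<noteq> {}" "B y \<subseteq> verts G'" if "y \<in> S" for y
    using that SV connected_in_verts[OF B] connected_in_nonempty[OF B] by auto
  then show "(\<Union>y\<in>S. B y) \<noteq> {}" "(\<Union>y\<in>S. B y) \<subseteq> verts G'"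
    using SV by auto
  fix T assume T: "T \<noteq> {}" "T \<subset> (\<Union>y\<in>S. B y)"
  show "\<exists>u\<in>T. \<exists>v\<in>(\<Union>y\<in>S. B y) - T. {u, v} \<in> edges G'"
  proof (cases "\<exists>y\<in>S. B y \<inter> T \<noteq> {} \<and> B y \<inter> T \<noteq> B y")
    case True
    then obtain y where y: "y \<in> S" "B y \<inter> T \<noteq> {}" "B y \<inter> T \<noteq> B y" by blast
    have "connected_in G' (B y)" using B SV y(1) by auto
    then obtain u v where "u \<in> B y \<inter> T" "v \<in> B y - B y \<inter> T" "{u, v} \<in> edges G'"
      using y by (rule_tac connected_in_cut[of G' "B y" "B y \<inter> T"]) auto
    then show ?thesis using y(1) by (intro bexI[of _ u] bexI[of _ v]) auto
  next
    case False
    let ?Y = "{y \<in> S. B y \<subseteq> T}"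
    have "?Y \<noteq> {}" "?Y \<noteq> S" using T False by blast+
    then obtain y z where yz: "y \<in> ?Y" "z \<in> S - ?Y" "{y, z} \<in> edges G"
      using connected_in_cut[OF S, of ?Y] by blast
    then show ?thesis using E[OF yz(3)] False by blast
  qed
qed

lemma graph_edge_verts: "is_graph G \<Longrightarrow> {x, y} \<in> edges G \<Longrightarrow> x \<in> verts G \<and> y \<in> verts G \<and> x \<noteq> y"
  unfolding is_graph_def by fastforce

lemma is_minorI:
  assumes "\<And>x. x \<in> verts H \<Longrightarrow> connected_in G (B x)"
    and "\<And>x y. x \<in> verts H \<Longrightarrow> y \<in> verts H \<Longrightarrow> x \<noteq> y \<Longrightarrow> B x \<inter> B y = {}"
    and "\<And>x y. {x, y} \<in> edges H \<Longrightarrow> \<exists>u\<in>B x. \<exists>v\<in>B y. {u, v} \<in> edges G"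
  shows "is_minor H G"
  unfolding is_minor_def using assms by blast

text \<open>With one-vertex branch sets, a minor is a subgraph up to renaming; all uses below that
  contract nothing go through this rule.\<close>

lemma is_minor_inj:
  assumes "is_graph H" "f ` verts H \<subseteq> verts G" "inj_on f (verts H)"
    and "\<And>x y. {x, y} \<in> edges H \<Longrightarrow> {f x, f y} \<in> edges G"
  shows "is_minor H G"
  by (rule is_minorI[where B = "\<lambda>x. {f x}"])
     (use assms in \<open>auto intro: connected_in_singleton dest: inj_onD\<close>)

lemma is_minor_refl: "is_graph G \<Longrightarrow> is_minor G G"
  by (rule is_minor_inj[where f = id]) auto

lemma is_minor_trans:
  assumes HG: "is_minor H G" and GK: "is_minor G K" and "is_graph H" "is_graph G"
  shows "is_minor H K"
proof -
  obtain B where B: "\<And>x. x \<in> verts H \<Longrightarrow> connected_in G (B x)"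
      "\<And>x y. x \<in> verts H \<Longrightarrow> y \<in> verts H \<Longrightarrow> x \<noteq> y \<Longrightarrow> B x \<inter> B y = {}"
      "\<And>x y. {x, y} \<in> edges H \<Longrightarrow> \<exists>u\<in>B x. \<exists>v\<in>B y. {u, v} \<in> edges G"
    using HG unfolding is_minor_def by blast
  obtain C where C: "\<And>x. x \<in> verts G \<Longrightarrow> connected_in K (C x)"
      "\<And>x y. x \<in> verts G \<Longrightarrow> y \<in> verts G \<Longrightarrow> x \<noteq> y \<Longrightarrow> C x \<inter> C y = {}"
      "\<And>x y. {x, y} \<in> edges G \<Longrightarrow> \<exists>u\<in>C x. \<exists>v\<in>C y. {u, v} \<in> edges K"
    using GK unfolding is_minor_def by blast
  show ?thesis
  proof (rule is_minorI[where B = "\<lambda>x. \<Union>y\<in>B x. C y"])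
    fix x assume "x \<in> verts H"
    then show "connected_in K (\<Union>y\<in>B x. C y)"
      using connected_in_UN_minor[of G "B x" K C] B(1) C by blast
  next
    fix x y assume xy: "x \<in> verts H" "y \<in> verts H" "x \<noteq> y"
    have "B x \<subseteq> verts G" "B y \<subseteq> verts G" "B x \<inter> B y = {}"
      using B xy connected_in_verts by auto
    then show "(\<Union>y\<in>B x. C y) \<inter> (\<Union>y\<in>B y. C y) = {}"
      using C(2) by fastforce
  next
    fix x y assume "{x, y} \<in> edges H"
    then show "\<exists>u\<in>\<Union>y\<in>B x. C y. \<exists>v\<in>\<Union>y\<in>B y. C y. {u, v} \<in> edges K"
      using B(3) C(3) by fastforce
  qed
qed

lemma minor_closed_minors_of:
  assumes "\<And>k. is_graph (F k)"
  shows "minor_closed_class (minors_of F)"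
  unfolding minor_closed_class_def minors_of_def using assms is_minor_trans by blast

lemma minors_of_subset:
  assumes "minor_closed_class \<G>" "\<And>k. k \<ge> 1 \<Longrightarrow> F k \<in> \<G>"
  shows "minors_of F \<subseteq> \<G>"
  using assms unfolding minor_closed_class_def minors_of_def by blast

lemma minors_of_member: "is_graph (F k) \<Longrightarrow> k \<ge> 1 \<Longrightarrow> F k \<in> minors_of F"
  unfolding minors_of_def using is_minor_refl by blast

lemma finite_edges: "is_graph G \<Longrightarrow> finite (edges G)"
  unfolding is_graph_def by (meson Pow_iff finite_Pow_iff finite_subset subsetI)

lemma edgeE:
  assumes "is_graph G" "e \<in> edges G"
  obtains x y where "e = {x, y}" "x \<noteq> y" "x \<in> verts G" "y \<in> verts G"
  using assms unfolding is_graph_def by (metis card_2_iff insert_subset)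

definition induce :: "graph \<Rightarrow> nat set \<Rightarrow> graph" where
  "induce G W = (W, {e \<in> edges G. e \<subseteq> W})"

lemma is_graph_induce: "is_graph G \<Longrightarrow> W \<subseteq> verts G \<Longrightarrow> is_graph (induce G W)"
  unfolding is_graph_def induce_def by (auto intro: finite_subset)

lemma induce_in_class:
  assumes "minor_closed_class \<G>" "G \<in> \<G>" "W \<subseteq> verts G"
  shows "induce G W \<in> \<G>"
proof -
  have "is_graph G" using assms unfolding minor_closed_class_def by blast
  then have g: "is_graph (induce G W)" using assms(3) by (rule is_graph_induce)
  moreover have "is_minor (induce G W) G"
    by (rule is_minor_inj[where f = id, OF g]) (use assms in \<open>auto simp: induce_def\<close>)
  ultimately show ?thesis using assms unfolding minor_closed_class_def by blast
qed

section \<open>Limiting density\<close>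

lemma graph_isoI:
  assumes "is_graph G" "is_graph H" "bij_betw f (verts G) (verts H)" "edges H = (\<lambda>e. f ` e) ` edges G"
  shows "(G, H) \<in> graph_iso"
  using assms unfolding graph_iso_def by blast

lemma sym_graph_iso: "sym graph_iso"
proof (rule symI)
  fix G H assume "(G, H) \<in> graph_iso"
  then obtain f where f: "is_graph G" "is_graph H" "bij_betw f (verts G) (verts H)"
    "edges H = (\<lambda>e. f ` e) ` edges G" unfolding graph_iso_def by blast
  have "inv_into (verts G) f ` f ` e = e" if "e \<in> edges G" for e
    using f that by (metis bij_betw_imp_inj_on inv_into_image_cancel is_graph_def)
  then have "edges G = (\<lambda>e. inv_into (verts G) f ` e) ` edges H"
    unfolding f by (force simp: image_image)
  then show "(H, G) \<in> graph_iso"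
    by (rule graph_isoI[OF f(2,1) bij_betw_inv_into[OF f(3)]])
qed

lemma trans_graph_iso: "trans graph_iso"
proof (rule transI)
  fix G H K assume GH: "(G, H) \<in> graph_iso" and HK: "(H, K) \<in> graph_iso"
  from GH obtain f where f: "is_graph G" "is_graph H" "bij_betw f (verts G) (verts H)"
    "edges H = (\<lambda>e. f ` e) ` edges G"
    unfolding graph_iso_def by blast
  from HK obtain g where g: "is_graph K" "bij_betw g (verts H) (verts K)"
    "edges K = (\<lambda>e. g ` e) ` edges H"
    unfolding graph_iso_def by blast
  have "edges K = (\<lambda>e. (g \<circ> f) ` e) ` edges G" unfolding f(4) g(3) by (simp add: image_image image_comp)
  then show "(G, K) \<in> graph_iso"
    by (rule graph_isoI[OF f(1) g(1) bij_betw_trans[OF f(3) g(2)]])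
qed

lemma graph_iso_lessThan:
  assumes "is_graph G"
  obtains H where "(G, H) \<in> graph_iso" "verts H = {..<card (verts G)}"
proof -
  have fin: "finite (verts G)" using assms unfolding is_graph_def by blast
  then obtain f where f: "bij_betw f (verts G) {..<card (verts G)}"
    by (metis bij_betw_iff_card card_lessThan finite_lessThan)
  let ?H = "({..<card (verts G)}, (\<lambda>e. f ` e) ` edges G)"
  have "f ` e \<subseteq> {..<card (verts G)} \<and> card (f ` e) = 2" if "e \<in> edges G" for e
  proof -
    have "e \<subseteq> verts G" "card e = 2" using that assms unfolding is_graph_def by auto
    then show ?thesis using f
      by (metis bij_betw_def card_image image_mono inj_on_subset)
  qed
  then have "is_graph ?H" unfolding is_graph_def by auto
  then have "(G, ?H) \<in> graph_iso" using assms f by (auto intro: graph_isoI)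
  then show ?thesis using that by auto
qed

text \<open>Each isomorphism type of order at most \<open>N\<close> has a representative on an
  initial segment of \<open>{..<N}\<close>, and there are finitely many of those. It serves in
  contraposed form: an infinite class has members of arbitrarily large order.\<close>

lemma finite_iso_classes:
  assumes G: "\<G> \<subseteq> {G. is_graph G}" and N: "\<And>G. G \<in> \<G> \<Longrightarrow> card (verts G) \<le> N"
  shows "finite (\<G> // graph_iso)"
proof -
  let ?A = "Pow {..<N} \<times> Pow (Pow {..<N})"
  have "\<G> // graph_iso \<subseteq> (\<lambda>H. graph_iso `` {H}) ` ?A"
  proof
    fix X assume "X \<in> \<G> // graph_iso"
    then obtain G where G': "G \<in> \<G>" "X = graph_iso `` {G}" by (auto elim: quotientE)
    then obtain H where H: "(G, H) \<in> graph_iso" "verts H = {..<card (verts G)}"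
      using graph_iso_lessThan G by blast
    have "is_graph H" using H unfolding graph_iso_def by blast
    then have "edges H \<subseteq> Pow (verts H)" unfolding is_graph_def by blast
    moreover have vN: "verts H \<subseteq> {..<N}" using N[OF G'(1)] H by auto
    ultimately have "edges H \<subseteq> Pow {..<N}" by blast
    with vN have "H \<in> ?A" by (metis PowI mem_Sigma_iff prod.collapse)
    moreover have "X = graph_iso `` {H}"
      using G' H sym_graph_iso trans_graph_iso by (auto dest: symD transD)
    ultimately show "X \<in> (\<lambda>H. graph_iso `` {H}) ` ?A" by blast
  qed
  then show ?thesis by (rule finite_subset) simp
qed

text \<open>The order is an isomorphism invariant, so it is well defined on types, and here it takes
  every natural number as a value.\<close>

lemma infinite_iso_classes:
  assumes G: "\<G> \<subseteq> {G. is_graph G}" and U: "\<And>n. \<exists>G\<in>\<G>. card (verts G) = n"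
  shows "infinite (\<G> // graph_iso)"
proof
  assume fin: "finite (\<G> // graph_iso)"
  let ?c = "\<lambda>X. card (verts (SOME G. G \<in> X))"
  have "n \<in> ?c ` (\<G> // graph_iso)" for n
  proof -
    obtain G where g: "G \<in> \<G>" "card (verts G) = n" using U by blast
    let ?X = "graph_iso `` {G}"
    have "G \<in> ?X" using G g by (auto intro!: graph_isoI[where f = id])
    then have "(SOME G. G \<in> ?X) \<in> ?X" by (rule someI)
    then have "card (verts (SOME G. G \<in> ?X)) = n"
      using g unfolding graph_iso_def by (auto dest: bij_betw_same_card)
    then show ?thesis using quotientI[OF g(1), of graph_iso] by blast
  qed
  then have "(UNIV :: nat set) \<subseteq> ?c ` (\<G> // graph_iso)" by blast
  then show False using fin by (meson finite_imageI finite_subset infinite_UNIV_nat)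
qed

text \<open>\<open>Max\<close> is meaningful only on finite nonempty sets: the bound
  \<open>u\<close> provides finiteness and \<open>H\<close> nonemptiness.\<close>

lemma ex_bounds:
  assumes G: "\<G> \<subseteq> {G. is_graph G}"
    and H: "H \<in> \<G>" "card (verts H) = n"
    and U: "\<And>G. G \<in> \<G> \<Longrightarrow> card (verts G) = n \<Longrightarrow> real (card (edges G)) \<le> u"
  shows "card (edges H) \<le> ex \<G> n" "real (ex \<G> n) \<le> u"
proof -
  let ?S = "{card (edges G) | G. G \<in> \<G> \<and> card (verts G) = n}"
  have "?S \<subseteq> {..nat \<lfloor>u\<rfloor>}" using U by (force simp: le_nat_floor)
  then have fin: "finite ?S" by (rule finite_subset) simp
  have "card (edges H) \<in> ?S" using H by blast
  then show "card (edges H) \<le> ex \<G> n" unfolding ex_def using fin by (rule Max_ge[rotated])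
  have "Max ?S \<in> ?S" using fin \<open>card (edges H) \<in> ?S\<close> by (intro Max_in) auto
  then show "real (ex \<G> n) \<le> u" unfolding ex_def using U by auto
qed

text \<open>The quotient is squeezed between \<open>a - c / n\<close> and \<open>a + c / n\<close>.
  The members of every order supplied by \<open>L\<close> also show that the class is infinite,
  which selects the \<open>lim\<close> branch of the definition.\<close>

lemma limiting_density_eqI:
  assumes G: "\<G> \<subseteq> {G. is_graph G}"
    and L: "\<And>n. \<exists>G\<in>\<G>. card (verts G) = n \<and> a * real n - c \<le> real (card (edges G))"
    and U: "\<And>G. G \<in> \<G> \<Longrightarrow> real (card (edges G)) \<le> a * real (card (verts G)) + c"
  shows "limiting_density \<G> = ereal a"
proof -
  have inf: "infinite (\<G> // graph_iso)" using infinite_iso_classes[OF G] L by blast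
  have B: "a * real n - c \<le> ex \<G> n" "ex \<G> n \<le> a * real n + c" for n
    using L[of n] ex_bounds[OF G, of _ n "a * real n + c"] U by fastforce+
  have "(\<lambda>n. real (ex \<G> n) / real n) \<longlonglongrightarrow> a"
  proof (rule tendsto_sandwich)
    have "\<forall>\<^sub>F n in sequentially. n > 0" by (rule eventually_gt_at_top)
    then show "\<forall>\<^sub>F n in sequentially. a - c / real n \<le> real (ex \<G> n) / real n"
    proof eventually_elim
      case (elim n)
      have "a - c / real n = (a * real n - c) / real n" using elim by (simp add: field_simps)
      then show ?case using B(1)[of n] by (simp add: divide_right_mono)
    qed
    have "\<forall>\<^sub>F n in sequentially. n > 0" by (rule eventually_gt_at_top)
    then show "\<forall>\<^sub>F n in sequentially. real (ex \<G> n) / real n \<le> a + c / real n"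
    proof eventually_elim
      case (elim n)
      have "a + c / real n = (a * real n + c) / real n" using elim by (simp add: field_simps)
      then show ?case using B(2)[of n] by (simp add: divide_right_mono)
    qed
    show "(\<lambda>n. a - c / real n) \<longlonglongrightarrow> a"
      using tendsto_diff[OF tendsto_const lim_const_over_n] by simp
    show "(\<lambda>n. a + c / real n) \<longlonglongrightarrow> a"
      using tendsto_add[OF tendsto_const lim_const_over_n] by simp
  qed
  then have "(\<lambda>n. ereal (real (ex \<G> n) / real n)) \<longlonglongrightarrow> ereal a" by simp
  then show ?thesis unfolding limiting_density_def using inf by (simp add: limI)
qed

section \<open>The three obstructions\<close>

lemma is_graph_complete_graph: "is_graph (complete_graph n)"
  unfolding is_graph_def complete_graph_def by auto

lemma is_graph_copies:
  assumes "is_graph H"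
  shows "is_graph (copies k H)"
proof -
  have "(\<lambda>v. prod_encode (i, v)) ` e \<subseteq> prod_encode ` ({..<k} \<times> verts H) \<and>
      card ((\<lambda>v. prod_encode (i, v)) ` e) = 2" if "i < k" "e \<in> edges H" for i e
  proof -
    have "e \<subseteq> verts H" "card e = 2" using assms that unfolding is_graph_def by auto
    moreover have "inj_on (\<lambda>v. prod_encode (i, v)) e" by (auto intro: inj_onI)
    ultimately show ?thesis using that by (auto simp: card_image)
  qed
  then have "\<forall>e\<in>edges (copies k H). e \<subseteq> verts (copies k H) \<and> card e = 2"
    unfolding copies_def by fastforce
  moreover have "finite (verts (copies k H))"
    using assms unfolding is_graph_def copies_def by simp
  ultimately show ?thesis unfolding is_graph_def by blast
qed

lemma is_graph_star: "is_graph (complete_bipartite 1 k)"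
  unfolding is_graph_def complete_bipartite_def by auto

lemma is_graph_path: "is_graph (path_graph k)"
  unfolding is_graph_def path_graph_def by auto

lemmas is_graph_triangles = is_graph_copies[OF is_graph_complete_graph]

lemma verts_copies: "verts (copies k H) = prod_encode ` ({..<k} \<times> verts H)"
  unfolding copies_def by simp

lemma verts_star: "verts (complete_bipartite 1 k) = {..k}"
  unfolding complete_bipartite_def by auto

lemma verts_path: "verts (path_graph k) = {..<k}"
  unfolding path_graph_def by auto

lemma edge_triangles:
  "{u, v} \<in> edges (copies k (complete_graph 3)) \<longleftrightarrow>
    (\<exists>i a b. i < k \<and> a < 3 \<and> b < 3 \<and> a \<noteq> b \<and> u = prod_encode (i, a) \<and> v = prod_encode (i, b))"
  (is "?L \<longleftrightarrow> ?R")
proof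
  assume ?L
  then obtain i e where ie: "i < k" "e \<subseteq> {..<3}" "card e = 2" "{u, v} = (\<lambda>v. prod_encode (i, v)) ` e"
    unfolding copies_def complete_graph_def by auto
  then obtain a b where "e = {a, b}" "a \<noteq> b" by (auto simp: card_2_iff)
  with ie show ?R by (auto simp: doubleton_eq_iff)
next
  assume ?R
  then obtain i a b where *: "i < k" "a < 3" "b < 3" "a \<noteq> b" "u = prod_encode (i, a)" "v = prod_encode (i, b)"
    by blast
  then have "{a, b} \<in> edges (complete_graph 3)" "{u, v} = (\<lambda>v. prod_encode (i, v)) ` {a, b}"
    unfolding complete_graph_def by auto
  then show ?L unfolding copies_def using \<open>i < k\<close> by (simp del: image_insert) blast
qed

lemma edge_star_1:
  "{u, v} \<in> edges (complete_bipartite 1 k) \<longleftrightarrow> (u = 0 \<and> 1 \<le> v \<and> v \<le> k) \<or> (v = 0 \<and> 1 \<le> u \<and> u \<le> k)"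
  unfolding complete_bipartite_def by (auto simp: doubleton_eq_iff)

text \<open>Simplification turns \<open>1\<close> into \<open>Suc 0\<close>; the second copy matches
  terms after that rewriting.\<close>

lemmas edge_star = edge_star_1 edge_star_1[unfolded One_nat_def]

lemma edge_path:
  "{u, v} \<in> edges (path_graph k) \<longleftrightarrow> (v = Suc u \<and> v < k) \<or> (u = Suc v \<and> u < k)"
  unfolding path_graph_def by (auto simp: doubleton_eq_iff)

section \<open>Shape and edge number of the minors of triangle copies, stars and paths\<close>

lemma minor_closed_G1: "minor_closed_class class_G1"
  unfolding class_G1_def by (rule minor_closed_minors_of) (rule is_graph_triangles)

lemma minor_closed_G2: "minor_closed_class class_G2"
  unfolding class_G2_def by (rule minor_closed_minors_of) (rule is_graph_star)

lemma minor_closed_G3: "minor_closed_class class_G3"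
  unfolding class_G3_def by (rule minor_closed_minors_of) (rule is_graph_path)

text \<open>No edge joins two copies, so the part of \<open>S\<close> in the copy of
  \<open>u\<close> cannot be a proper part.\<close>

lemma connected_in_copies:
  assumes S: "connected_in (copies k H) S" and uv: "u \<in> S" "v \<in> S"
  shows "fst (prod_decode u) = fst (prod_decode v)"
proof (rule ccontr)
  assume n: "\<not> ?thesis"
  let ?T = "{w \<in> S. fst (prod_decode w) = fst (prod_decode u)}"
  have "u \<in> ?T" "v \<notin> ?T" using uv n by auto
  then have "?T \<noteq> {}" "?T \<subseteq> S" "?T \<noteq> S" using uv by blast+
  then obtain w x where wx: "w \<in> ?T" "x \<in> S - ?T" and e: "{w, x} \<in> edges (copies k H)"
    by (rule connected_in_cut[OF S])
  obtain i d where "{w, x} = (\<lambda>v. prod_encode (i, v)) ` d"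
    using e unfolding copies_def by auto
  then have "w \<in> (\<lambda>v. prod_encode (i, v)) ` d" "x \<in> (\<lambda>v. prod_encode (i, v)) ` d" by blast+
  then have "fst (prod_decode w) = fst (prod_decode x)" by auto
  with wx show False by auto
qed

text \<open>A connected branch set lies in a single copy, whose index is \<open>i x\<close>;
  adjacent vertices share it. A triangle has room for at most three disjoint branch sets, which
  bounds the fibres of \<open>i\<close>.\<close>

lemma class_G1_fibres:
  assumes H: "H \<in> class_G1"
  obtains i :: "nat \<Rightarrow> nat" where "\<And>x y. {x, y} \<in> edges H \<Longrightarrow> i x = i y"
    "\<And>c. card {x \<in> verts H. i x = c} \<le> 3"
proof -
  have gH: "is_graph H" using H unfolding class_G1_def minors_of_def by blast
  obtain k B where B: "\<And>x. x \<in> verts H \<Longrightarrow> connected_in (copies k (complete_graph 3)) (B x)"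
      "\<And>x y. x \<in> verts H \<Longrightarrow> y \<in> verts H \<Longrightarrow> x \<noteq> y \<Longrightarrow> B x \<inter> B y = {}"
      "\<And>x y. {x, y} \<in> edges H \<Longrightarrow> \<exists>u\<in>B x. \<exists>v\<in>B y. {u, v} \<in> edges (copies k (complete_graph 3))"
    using H unfolding class_G1_def minors_of_def is_minor_def by blast
  define p where "p x = (SOME u. u \<in> B x)" for x
  define i where "i x = fst (prod_decode (p x))" for x
  have p: "p x \<in> B x" if "x \<in> verts H" for x
    unfolding p_def using connected_in_nonempty[OF B(1)[OF that]] by (simp add: some_in_eq)
  have inj: "inj_on p (verts H)" using p B(2) by (metis disjoint_iff inj_onI)
  show ?thesis
  proof (rule that[of i])
    fix x y assume e: "{x, y} \<in> edges H"
    then have xy: "x \<in> verts H" "y \<in> verts H" using graph_edge_verts[OF gH] by auto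
    obtain u v where uv: "u \<in> B x" "v \<in> B y" "{u, v} \<in> edges (copies k (complete_graph 3))"
      using B(3)[OF e] by blast
    then have "fst (prod_decode u) = fst (prod_decode v)" by (auto simp: edge_triangles)
    then show "i x = i y" unfolding i_def
      using connected_in_copies[OF B(1)] xy uv p by metis
  next
    fix c
    \<comment> \<open>The chosen points \<open>p x\<close> of disjoint branch sets are distinct, so
      they inject a fibre into the three vertices of copy \<open>c\<close>.\<close>
    have "p ` {x \<in> verts H. i x = c} \<subseteq> (\<lambda>v. prod_encode (c, v)) ` {..<3}"
    proof
      fix u assume "u \<in> p ` {x \<in> verts H. i x = c}"
      then obtain x where x: "x \<in> verts H" "i x = c" "u = p x" by blast
      then have "u \<in> verts (copies k (complete_graph 3))"
        using p connected_in_verts[OF B(1)] by blast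
      then show "u \<in> (\<lambda>v. prod_encode (c, v)) ` {..<3}"
        using x unfolding verts_copies i_def complete_graph_def by auto
    qed
    then have "card (p ` {x \<in> verts H. i x = c}) \<le> card ((\<lambda>v. prod_encode (c, v)) ` {..<3::nat})"
      by (intro card_mono) auto
    also have "\<dots> \<le> 3" using card_image_le[of "{..<3::nat}"] by simp
    also have "card (p ` {x \<in> verts H. i x = c}) = card {x \<in> verts H. i x = c}"
      using inj by (intro card_image) (auto intro: inj_on_subset)
    finally show "card {x \<in> verts H. i x = c} \<le> 3" .
  qed
qed

text \<open>Double counting of incidences: each edge is met twice, each vertex at most
  twice.\<close>

lemma card_edges_le_verts:
  assumes H: "is_graph H" and d: "\<And>x. x \<in> verts H \<Longrightarrow> card {e \<in> edges H. x \<in> e} \<le> 2"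
  shows "card (edges H) \<le> card (verts H)"
proof -
  have fin: "finite (verts H)" "finite (edges H)" using H finite_edges unfolding is_graph_def by auto
  have "(\<Sum>x\<in>verts H. card {e \<in> edges H. x \<in> e}) = 2 * card (edges H)"
  proof (rule sum_multicount[OF fin], rule ballI)
    fix e assume "e \<in> edges H"
    then have "card e = 2" "{x \<in> verts H. x \<in> e} = e" using H unfolding is_graph_def by auto
    then show "card {x \<in> verts H. x \<in> e} = 2" by simp
  qed
  moreover have "(\<Sum>x\<in>verts H. card {e \<in> edges H. x \<in> e}) \<le> (\<Sum>x\<in>verts H. 2)"
    by (rule sum_mono) (rule d)
  ultimately show ?thesis by simp
qed

text \<open>All neighbours of a vertex lie in its fibre of at most three elements, so degrees are at
  most 2.\<close>

lemma class_G1_edges: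
  assumes H: "H \<in> class_G1"
  shows "card (edges H) \<le> card (verts H)"
proof -
  have gH: "is_graph H" using H unfolding class_G1_def minors_of_def by blast
  obtain i :: "nat \<Rightarrow> nat" where i: "\<And>x y. {x, y} \<in> edges H \<Longrightarrow> i x = i y"
    "\<And>c. card {x \<in> verts H. i x = c} \<le> 3" using class_G1_fibres[OF H] by blast
  show ?thesis
  proof (rule card_edges_le_verts[OF gH])
    fix x assume x: "x \<in> verts H"
    let ?F = "{y \<in> verts H. i y = i x}"
    have fin: "finite ?F" using gH unfolding is_graph_def by auto
    have "{e \<in> edges H. x \<in> e} \<subseteq> (\<lambda>y. {x, y}) ` (?F - {x})"
    proof
      fix e assume e: "e \<in> {e \<in> edges H. x \<in> e}"
      then obtain a b where ab: "e = {a, b}" "a \<noteq> b" "a \<in> verts H" "b \<in> verts H"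
        using edgeE[OF gH] by blast
      then have "i a = i b" using i e by blast
      then show "e \<in> (\<lambda>y. {x, y}) ` (?F - {x})" using ab e by auto
    qed
    then have "card {e \<in> edges H. x \<in> e} \<le> card ((\<lambda>y. {x, y}) ` (?F - {x}))"
      using fin by (intro card_mono) auto
    also have "\<dots> \<le> card (?F - {x})" using fin by (intro card_image_le) auto
    also have "\<dots> \<le> 2" using i(2)[of "i x"] x fin by (simp add: card_Diff_singleton)
    finally show "card {e \<in> edges H. x \<in> e} \<le> 2" .
  qed
qed

text \<open>Every edge of the star uses its centre 0, so every edge of \<open>H\<close> has an end
  whose branch set contains 0. Branch sets being disjoint, this is always the same vertex. Without
  edges any \<open>c\<close> will do.\<close>

lemma class_G2_centre:
  assumes H: "H \<in> class_G2"
  obtains c where "\<And>e. e \<in> edges H \<Longrightarrow> c \<in> e"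
proof -
  have gH: "is_graph H" using H unfolding class_G2_def minors_of_def by blast
  obtain k B where B: "\<And>x y. x \<in> verts H \<Longrightarrow> y \<in> verts H \<Longrightarrow> x \<noteq> y \<Longrightarrow> B x \<inter> B y = {}"
      "\<And>x y. {x, y} \<in> edges H \<Longrightarrow> \<exists>u\<in>B x. \<exists>v\<in>B y. {u, v} \<in> edges (complete_bipartite 1 k)"
    using H unfolding class_G2_def minors_of_def is_minor_def by blast
  have 0: "\<exists>z\<in>e. z \<in> verts H \<and> 0 \<in> B z" if "e \<in> edges H" for e
  proof -
    obtain x y where xy: "e = {x, y}" "x \<in> verts H" "y \<in> verts H" using edgeE[OF gH \<open>e \<in> edges H\<close>] by blast
    then obtain u v where "u \<in> B x" "v \<in> B y" "{u, v} \<in> edges (complete_bipartite 1 k)"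
      using B(2) \<open>e \<in> edges H\<close> by blast
    then show ?thesis using xy by (auto simp: edge_star)
  qed
  show ?thesis
  proof (cases "edges H = {}")
    case True then show ?thesis using that by blast
  next
    case False
    then obtain c where "c \<in> verts H" "0 \<in> B c" using 0 by blast
    then have "z = c" if "z \<in> verts H" "0 \<in> B z" for z using that B(1) by blast
    then show ?thesis using that 0 by blast
  qed
qed

lemma class_G2_edges:
  assumes H: "H \<in> class_G2"
  shows "card (edges H) \<le> card (verts H)"
proof -
  have gH: "is_graph H" using H unfolding class_G2_def minors_of_def by blast
  then have fin: "finite (verts H)" unfolding is_graph_def by blast
  obtain c where c: "\<And>e. e \<in> edges H \<Longrightarrow> c \<in> e" using class_G2_centre[OF H] by blast
  have "e \<in> (\<lambda>y. {c, y}) ` verts H" if "e \<in> edges H" for e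
    using edgeE[OF gH that] c[OF that] by blast
  then have "card (edges H) \<le> card ((\<lambda>y. {c, y}) ` verts H)"
    using fin by (intro card_mono) auto
  also have "\<dots> \<le> card (verts H)" by (rule card_image_le[OF fin])
  finally show ?thesis .
qed

text \<open>Connected sets of a path are intervals: an edge across the cut below a missing
  \<open>c\<close> would have to jump over \<open>c\<close>.\<close>

lemma connected_in_path:
  assumes S: "connected_in (path_graph k) S" and ab: "a \<in> S" "b \<in> S" "a \<le> c" "c \<le> b"
  shows "c \<in> S"
proof (rule ccontr)
  assume n: "c \<notin> S"
  let ?T = "{x \<in> S. x < c}"
  have "a < c" "b \<noteq> c" using ab n by (metis le_neq_implies_less)+
  then have "a \<in> ?T" "b \<notin> ?T" using ab by auto
  then have "?T \<noteq> {}" "?T \<subseteq> S" "?T \<noteq> S" using ab by blast+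
  then obtain u v where "u \<in> ?T" "v \<in> S - ?T" "{u, v} \<in> edges (path_graph k)"
    by (rule connected_in_cut[OF S])
  then show False using n by (auto simp: edge_path) (metis Suc_leI le_antisym not_less)
qed

text \<open>This describes linear forests, that is, disjoint unions of paths: in the order given by
  \<open>m\<close>, each vertex has at most one neighbour on either side. A cycle is excluded
  because its lowest vertex would have two neighbours above it.\<close>

definition path_layout :: "graph \<Rightarrow> (nat \<Rightarrow> nat) \<Rightarrow> bool" where
  "path_layout H m \<longleftrightarrow> inj_on m (verts H) \<and>
    (\<forall>x y z. {x, y} \<in> edges H \<longrightarrow> {x, z} \<in> edges H \<longrightarrow> m x < m y \<longrightarrow> m x < m z \<longrightarrow> y = z) \<and>
    (\<forall>x y z. {x, y} \<in> edges H \<longrightarrow> {x, z} \<in> edges H \<longrightarrow> m y < m x \<longrightarrow> m z < m x \<longrightarrow> y = z)"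

lemma path_layoutD:
  assumes "path_layout H m"
  shows "inj_on m (verts H)"
    "\<And>x y z. {x, y} \<in> edges H \<Longrightarrow> {x, z} \<in> edges H \<Longrightarrow> m x < m y \<Longrightarrow> m x < m z \<Longrightarrow> y = z"
    "\<And>x y z. {x, y} \<in> edges H \<Longrightarrow> {x, z} \<in> edges H \<Longrightarrow> m y < m x \<Longrightarrow> m z < m x \<Longrightarrow> y = z"
  using assms unfolding path_layout_def by simp_all

text \<open>Branch sets are disjoint intervals of the path, and \<open>m\<close> orders them by
  their last points.\<close>

lemma class_G3_layout:
  assumes H: "H \<in> class_G3"
  obtains m where "path_layout H m"
proof -
  have gH: "is_graph H" using H unfolding class_G3_def minors_of_def by blast
  obtain k B where B: "\<And>x. x \<in> verts H \<Longrightarrow> connected_in (path_graph k) (B x)"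
      "\<And>x y. x \<in> verts H \<Longrightarrow> y \<in> verts H \<Longrightarrow> x \<noteq> y \<Longrightarrow> B x \<inter> B y = {}"
      "\<And>x y. {x, y} \<in> edges H \<Longrightarrow> \<exists>u\<in>B x. \<exists>v\<in>B y. {u, v} \<in> edges (path_graph k)"
    using H unfolding class_G3_def minors_of_def is_minor_def by blast
  define m where "m x = Max (B x)" for x
  have fin: "finite (B x)" if "x \<in> verts H" for x
    using connected_in_verts[OF B(1)[OF that]] by (auto simp: verts_path intro: finite_subset)
  have m: "m x \<in> B x" "\<And>u. u \<in> B x \<Longrightarrow> u \<le> m x" if "x \<in> verts H" for x
    unfolding m_def using fin[OF that] connected_in_nonempty[OF B(1)[OF that]] by auto
  have inj: "inj_on m (verts H)" using m B(2) by (metis disjoint_iff inj_onI)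
  \<comment> \<open>The interval \<open>B y\<close> ends beyond \<open>m x\<close> and avoids
    \<open>m x\<close>, hence lies entirely above it, while \<open>B x\<close> ends at
    \<open>m x\<close>. An edge of the path between them must go from \<open>m x\<close> to its
    successor. By disjointness, only one \<open>y\<close> can own that point.\<close>
  have nxt: "Suc (m x) \<in> B y" if e: "{x, y} \<in> edges H" and l: "m x < m y" for x y
  proof -
    have xy: "x \<in> verts H" "y \<in> verts H" "x \<noteq> y" using graph_edge_verts[OF gH e] by auto
    have nB: "u \<notin> B y" if "u \<in> B x" for u using B(2)[OF xy] that by blast
    obtain u v where uv: "u \<in> B x" "v \<in> B y" "{u, v} \<in> edges (path_graph k)" using B(3)[OF e] by blast
    have "\<not> v \<le> m x"
      using connected_in_path[OF B(1)[OF xy(2)] uv(2) m(1)[OF xy(2)], of "m x"] nB[OF m(1)[OF xy(1)]] l by auto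
    moreover have "u \<le> m x" using m xy uv by blast
    ultimately have "v = Suc (m x)" using uv(3) by (auto simp: edge_path)
    then show ?thesis using uv by simp
  qed
  have "path_layout H m"
    unfolding path_layout_def
  proof (intro conjI allI impI inj)
    fix x y z assume e: "{x, y} \<in> edges H" "{x, z} \<in> edges H"
    have v: "y \<in> verts H" "z \<in> verts H" "x \<in> verts H" "x \<noteq> y" "x \<noteq> z"
      using graph_edge_verts[OF gH e(1)] graph_edge_verts[OF gH e(2)] by auto
    show "y = z" if "m x < m y" "m x < m z"
      using nxt[OF e(1) that(1)] nxt[OF e(2) that(2)] B(2) v by blast
    show "y = z" if l: "m y < m x" "m z < m x"
    proof (rule ccontr)
      assume "y \<noteq> z"
      \<comment> \<open>Of two lower neighbours \<open>p\<close>, \<open>q\<close> with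
        \<open>p\<close> further down, \<open>B x\<close> would start right after \<open>m p\<close>
        and extend to \<open>m x\<close>, thus swallow the point \<open>m q\<close> of
        \<open>B q\<close>.\<close>
      have *: False if "m p < m q" "m q < m x" "{x, p} \<in> edges H" "q \<in> verts H" "x \<noteq> q" for p q
      proof -
        have "Suc (m p) \<in> B x" using nxt[of p x] that by (simp add: insert_commute)
        then have "m q \<in> B x" 
          using connected_in_path[OF B(1)[OF v(3)] _ m(1)[OF v(3)], of _ "m q"] that by auto
        then show False using m(1)[OF that(4)] B(2)[OF v(3) that(4,5)] by blast
      qed
      have "m y \<noteq> m z" using inj v \<open>y \<noteq> z\<close> by (meson inj_onD)
      then show False using *[of y z] *[of z y] l e v by linarith
    qed
  qed
then show ?thesis by (rule that)
qed

lemma class_G3_edges: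
  assumes H: "H \<in> class_G3"
  shows "card (edges H) \<le> card (verts H)"
proof -
  have gH: "is_graph H" using H unfolding class_G3_def minors_of_def by blast
  then have fin: "finite (verts H)" unfolding is_graph_def by blast
  obtain m where "path_layout H m" using class_G3_layout[OF H] by blast
  note m = path_layoutD[OF this]
  \<comment> \<open>Each edge is recovered from its lower end, because the neighbour above is
    unique; a vertex with no neighbour above gives an irrelevant value.\<close>
  let ?up = "\<lambda>x. {x, THE y. {x, y} \<in> edges H \<and> m x < m y}"
  have "e \<in> ?up ` verts H" if "e \<in> edges H" for e
  proof -
    have up: "{x, y} \<in> ?up ` verts H" if "{x, y} \<in> edges H" "m x < m y" "x \<in> verts H" for x y
    proof -
      have "(THE y. {x, y} \<in> edges H \<and> m x < m y) = y"
        using that m(2) by (intro the_equality) auto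
      then show ?thesis using that by blast
    qed
    obtain x y where xy: "e = {x, y}" "x \<noteq> y" "x \<in> verts H" "y \<in> verts H" using edgeE[OF gH \<open>e \<in> edges H\<close>] by blast
    then have "m x \<noteq> m y" using m(1) by (meson inj_onD)
    then show ?thesis using up[of x y] up[of y x] xy that by (metis insert_commute linorder_neqE_nat)
  qed
  then have "card (edges H) \<le> card (?up ` verts H)" using fin by (intro card_mono) auto
  also have "\<dots> \<le> card (verts H)" by (rule card_image_le[OF fin])
  finally show ?thesis .
qed

section \<open>Small graphs showing that the three classes are incomparable\<close>

lemma triangle_edges:
  "a < 3 \<Longrightarrow> b < 3 \<Longrightarrow> a \<noteq> b \<Longrightarrow>
    {prod_encode (0, a), prod_encode (0, b)} \<in> edges (copies 1 (complete_graph 3))"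
  unfolding edge_triangles by blast

lemma triangle_not_G2: "copies 1 (complete_graph 3) \<notin> class_G2"
proof
  assume "copies 1 (complete_graph 3) \<in> class_G2"
  then obtain c where c: "\<And>e. e \<in> edges (copies 1 (complete_graph 3)) \<Longrightarrow> c \<in> e"
    using class_G2_centre by blast
  show False
    using c[OF triangle_edges[of 0 1]] c[OF triangle_edges[of 1 2]] c[OF triangle_edges[of 0 2]] by auto
qed

text \<open>In any layout the lowest of the three vertices has two neighbours above it.\<close>

lemma triangle_not_G3: "copies 1 (complete_graph 3) \<notin> class_G3"
proof
  let ?K = "copies 1 (complete_graph 3)" and ?e = "\<lambda>a. prod_encode (0, a)"
  assume K: "?K \<in> class_G3"
  obtain m where "path_layout ?K m" using class_G3_layout[OF K] by blast
  note m = path_layoutD[OF this]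
  have v: "?e a \<in> verts ?K" if "a < 3" for a
    using that by (auto simp: verts_copies complete_graph_def)
  have ne: "m (?e a) \<noteq> m (?e b)" if "a < 3" "b < 3" "a \<noteq> b" for a b
    using m(1) v that by (metis Pair_inject inj_onD prod_encode_eq)
  have up: "\<not> (m (?e a) < m (?e b) \<and> m (?e a) < m (?e c))"
    if "a < 3" "b < 3" "c < 3" "a \<noteq> b" "a \<noteq> c" "b \<noteq> c" for a b c
    using m(2)[OF triangle_edges triangle_edges, of a b c] that by auto
  show False
    using ne[of 0 1] ne[of 1 2] ne[of 0 2] up[of 0 1 2] up[of 1 0 2] up[of 2 0 1] by simp linarith
qed

text \<open>The edges at the centre force all four vertices into one fibre, one more than a fibre
  can hold.\<close>

lemma star_not_G1: "complete_bipartite 1 3 \<notin> class_G1"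
proof
  let ?K = "complete_bipartite 1 3"
  assume K: "?K \<in> class_G1"
  obtain i :: "nat \<Rightarrow> nat" where i: "\<And>x y. {x, y} \<in> edges ?K \<Longrightarrow> i x = i y"
    "\<And>c. card {x \<in> verts ?K. i x = c} \<le> 3" using class_G1_fibres[OF K] by blast
  have "i x = i 0" if "x \<le> 3" for x
  proof (cases "x = 0")
    case False
    then have "{x, 0} \<in> edges ?K" using that by (simp add: edge_star)
    then show ?thesis by (rule i(1))
  qed simp
  then have eq: "{x \<in> verts ?K. i x = i 0} = {..3}" unfolding verts_star by blast
  have "card {..3::nat} \<le> 3" by (subst eq[symmetric]) (rule i(2))
  then show False by simp
qed

text \<open>Two of the three leaves must lie on the same side of the centre in the layout.\<close>

lemma star_not_G3: "complete_bipartite 1 3 \<notin> class_G3"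
proof
  let ?K = "complete_bipartite 1 3"
  assume K: "?K \<in> class_G3"
  obtain m where "path_layout ?K m" using class_G3_layout[OF K] by blast
  note m = path_layoutD[OF this]
  have e: "{0, a} \<in> edges ?K" if "1 \<le> a" "a \<le> 3" for a using that by (simp add: edge_star)
  have ne: "m 0 \<noteq> m a" if "1 \<le> a" "a \<le> 3" for a
    using m(1) that unfolding inj_on_def verts_star by force
  have up: "\<not> (m 0 < m a \<and> m 0 < m b)" and down: "\<not> (m a < m 0 \<and> m b < m 0)"
    if "1 \<le> a" "a < b" "b \<le> 3" for a b
    using m(2,3)[OF e[of a] e[of b]] that by auto
  show False
    using up[of 1 2] up[of 1 3] up[of 2 3] down[of 1 2] down[of 1 3] down[of 2 3] ne[of 1] ne[of 2] ne[of 3]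
    by simp linarith
qed

lemma path_not_G1: "path_graph 4 \<notin> class_G1"
proof
  let ?K = "path_graph 4"
  assume K: "?K \<in> class_G1"
  obtain i :: "nat \<Rightarrow> nat" where i: "\<And>x y. {x, y} \<in> edges ?K \<Longrightarrow> i x = i y"
    "\<And>c. card {x \<in> verts ?K. i x = c} \<le> 3" using class_G1_fibres[OF K] by blast
  have "i x = i 0" if "x < 4" for x
    using that
  proof (induction x)
    case (Suc x)
    then have "{Suc x, x} \<in> edges ?K" by (simp add: edge_path)
    then have "i (Suc x) = i x" by (rule i(1))
    with Suc show ?case by simp
  qed simp
  then have eq: "{x \<in> verts ?K. i x = i 0} = {..<4}" unfolding verts_path by blast
  have "card {..<4::nat} \<le> 3" by (subst eq[symmetric]) (rule i(2))
  then show False by simp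
qed

text \<open>The two end edges of the path are disjoint, so no vertex lies on all edges.\<close>

lemma path_not_G2: "path_graph 4 \<notin> class_G2"
proof
  assume "path_graph 4 \<in> class_G2"
  then obtain c where c: "\<And>e. e \<in> edges (path_graph 4) \<Longrightarrow> c \<in> e"
    using class_G2_centre by blast
  have "{0, 1} \<in> edges (path_graph 4)" "{2, 3} \<in> edges (path_graph 4)"
    unfolding edge_path by auto
  from this[THEN c] show False by auto
qed

section \<open>Properness and density of the three classes\<close>

lemma triangles_in_G1: "k \<ge> 1 \<Longrightarrow> copies k (complete_graph 3) \<in> class_G1"
  unfolding class_G1_def by (rule minors_of_member[where F = "\<lambda>k. copies k (complete_graph 3)"])
    (rule is_graph_triangles)

lemma star_in_G2: "k \<ge> 1 \<Longrightarrow> complete_bipartite 1 k \<in> class_G2"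
  unfolding class_G2_def by (rule minors_of_member[where F = "complete_bipartite 1"]) (rule is_graph_star)

lemma path_in_G3: "k \<ge> 1 \<Longrightarrow> path_graph k \<in> class_G3"
  unfolding class_G3_def by (rule minors_of_member[where F = path_graph]) (rule is_graph_path)

lemma proper_G1: "proper_class class_G1" and proper_G2: "proper_class class_G2"
  and proper_G3: "proper_class class_G3"
  unfolding proper_class_def
  using star_not_G1 is_graph_star triangle_not_G2 triangle_not_G3 is_graph_triangles by blast+

lemma card_edges_star: "k \<le> card (edges (complete_bipartite 1 k))"
proof -
  have "inj_on (\<lambda>j::nat. {0, j}) {1..k}" by (auto intro!: inj_onI simp: doubleton_eq_iff)
  then have "k = card ((\<lambda>j. {0, j}) ` {1..k})" by (simp add: card_image)
  also have "\<dots> \<le> card (edges (complete_bipartite 1 k))"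
    by (rule card_mono[OF finite_edges[OF is_graph_star]]) (auto simp: edge_star)
  finally show ?thesis .
qed

lemma card_edges_path: "k - 1 \<le> card (edges (path_graph k))"
proof -
  have "i = j" if "{i, Suc i} = {j, Suc j}" for i j
    using that unfolding doubleton_eq_iff by linarith
  then have "inj_on (\<lambda>j::nat. {j, Suc j}) {..<k - 1}" by (rule inj_onI)
  then have "k - 1 = card ((\<lambda>j. {j, Suc j}) ` {..<k - 1})" by (simp add: card_image)
  also have "\<dots> \<le> card (edges (path_graph k))"
    by (rule card_mono[OF finite_edges[OF is_graph_path]]) (auto simp: edge_path)
  finally show ?thesis .
qed

lemma card_edges_triangles: "3 * k \<le> card (edges (copies k (complete_graph 3)))"
proof -
  \<comment> \<open>The pair \<open>(i, a)\<close> names the edge of the \<open>i\<close>-th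
    triangle opposite to its vertex \<open>a\<close>.\<close>
  let ?f = "\<lambda>(i, a). prod_encode ` ({i} \<times> ({..<3} - {a::nat}))"
  have three: "{..<3::nat} = {0, 1, 2}" by auto
  have "inj_on ?f ({..<k} \<times> {..<3})"
  proof (rule inj_onI, clarsimp)
    fix i a j b :: nat
    assume ab: "a < 3" "b < 3"
      and "prod_encode ` ({i} \<times> ({..<3} - {a})) = prod_encode ` ({j} \<times> ({..<3} - {b}))"
    then have eq: "{i} \<times> ({..<3} - {a}) = {j} \<times> ({..<3} - {b})"
      by (simp only: inj_image_eq_iff[OF inj_prod_encode])
    have "{..<3} - {a} \<noteq> {}" using ab unfolding three by auto
    with eq have "i = j" "{..<3} - {a} = {..<3} - {b}" by (metis times_eq_iff singleton_inject insert_not_empty)+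
    then show "i = j \<and> a = b" using ab by (metis Diff_iff insertI1 lessThan_iff singletonD)
  qed
  then have "3 * k = card (?f ` ({..<k} \<times> {..<3}))" by (simp add: card_image card_cartesian_product)
  also have "\<dots> \<le> card (edges (copies k (complete_graph 3)))"
  proof (rule card_mono[OF finite_edges[OF is_graph_triangles]], clarsimp)
    fix i a :: nat assume "i < k" "a < 3"
    moreover have "prod_encode ` ({i} \<times> ({..<3} - {a})) = (\<lambda>v. prod_encode (i, v)) ` ({..<3} - {a})" by auto
    moreover have "{..<3} - {a} \<in> edges (complete_graph 3)"
      unfolding complete_graph_def using \<open>a < 3\<close> by auto
    ultimately show "prod_encode ` ({i} \<times> ({..<3} - {a})) \<in> edges (copies k (complete_graph 3))"
      unfolding copies_def by auto
  qed
  finally show ?thesis .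
qed

lemma minor_closed_graphs: "minor_closed_class \<G> \<Longrightarrow> \<G> \<subseteq> {G. is_graph G}"
  unfolding minor_closed_class_def by blast

text \<open>This covers order 0, as stars and paths with \<open>k \<ge> 1\<close> have
  vertices.\<close>

lemma empty_graph_in_class:
  assumes "minor_closed_class \<G>" "G \<in> \<G>"
  shows "\<exists>G\<in>\<G>. card (verts G) = 0"
  using induce_in_class[OF assms, of "{}"] by (auto intro!: bexI[of _ "induce G {}"] simp: induce_def)

lemma limiting_density_G1: "limiting_density class_G1 = 1"
proof -
  have "limiting_density class_G1 = ereal 1"
  proof (rule limiting_density_eqI[OF minor_closed_graphs[OF minor_closed_G1], where c = 3])
    show "real (card (edges G)) \<le> 1 * real (card (verts G)) + 3" if "G \<in> class_G1" for G
      using class_G1_edges[OF that] by simp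
    fix n :: nat
    let ?T = "\<lambda>k. copies k (complete_graph 3)" and ?k = "n div 3"
    have cT: "card (verts (?T k)) = 3 * k" for k
      unfolding verts_copies complete_graph_def
      by (simp add: card_image inj_prod_encode inj_on_subset[OF inj_prod_encode] card_cartesian_product)
    have "verts (?T ?k) \<subseteq> verts (?T (?k + 1))" unfolding verts_copies by auto
    moreover have "finite (verts (?T (?k + 1)))" using is_graph_triangles unfolding is_graph_def by blast
    moreover have "3 * ?k \<le> n" "n \<le> 3 * (?k + 1)" by presburger+
    \<comment> \<open>For orders not divisible by 3, the vertex set is chosen between those of
      \<open>n div 3\<close> and of one more triangle; the complete triangles alone give at least
      \<open>n - 3\<close> edges, whence \<open>c = 3\<close>.\<close>
    ultimately obtain W where W: "verts (?T ?k) \<subseteq> W" "W \<subseteq> verts (?T (?k + 1))" "card W = n"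
      using exists_subset_between[of "verts (?T ?k)" n "verts (?T (?k + 1))"] unfolding cT by blast
    let ?G = "induce (?T (?k + 1)) W"
    have G: "?G \<in> class_G1" using induce_in_class[OF minor_closed_G1 triangles_in_G1 W(2)] by simp
    have "edges (?T ?k) \<subseteq> edges ?G"
    proof
      fix e assume e: "e \<in> edges (?T ?k)"
      then have "e \<subseteq> W" using W is_graph_triangles unfolding is_graph_def by blast
      \<comment> \<open>The labels \<open>prod_encode (i, v)\<close> do not depend on the number of
        copies, so the graphs are nested.\<close>
      moreover have "e \<in> edges (?T (?k + 1))" using e unfolding copies_def by (simp, metis less_SucI)
      ultimately show "e \<in> edges ?G" unfolding induce_def by simp
    qed
    moreover have "is_graph ?G" using is_graph_induce[OF is_graph_triangles W(2)] .
    ultimately have "3 * ?k \<le> card (edges ?G)"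
      using card_mono[OF finite_edges] card_edges_triangles le_trans by blast
    then have "n \<le> card (edges ?G) + 3" by simp
    then show "\<exists>G\<in>class_G1. card (verts G) = n \<and> 1 * real n - 3 \<le> real (card (edges G))"
      using G W by (intro bexI[of _ ?G]) (auto simp: induce_def)
  qed
  then show ?thesis by (simp add: one_ereal_def)
qed

lemma limiting_density_G2: "limiting_density class_G2 = 1"
proof -
  have "limiting_density class_G2 = ereal 1"
  proof (rule limiting_density_eqI[OF minor_closed_graphs[OF minor_closed_G2], where c = 3])
    show "real (card (edges G)) \<le> 1 * real (card (verts G)) + 3" if "G \<in> class_G2" for G
      using class_G2_edges[OF that] by simp
    fix n :: nat
    \<comment> \<open>A star with \<open>k \<ge> 1\<close> leaves has \<open>k + 1 \<ge> 2\<close>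
      vertices, so orders 0 and 1 come from induced subgraphs.\<close>
    consider "n = 0" | "n = 1" | k where "n = Suc k" "k \<ge> 1"
      by (cases n) (auto simp: Suc_le_eq)
    then show "\<exists>G\<in>class_G2. card (verts G) = n \<and> 1 * real n - 3 \<le> real (card (edges G))"
    proof cases
      case 1
      then show ?thesis using empty_graph_in_class[OF minor_closed_G2 star_in_G2[of 1]] by auto
    next
      case 2
      then show ?thesis using induce_in_class[OF minor_closed_G2 star_in_G2[of 1], of "{0}"]
        by (intro bexI[of _ "induce (complete_bipartite 1 1) {0}"]) (auto simp: induce_def verts_star[of 1, simplified])
    next
      case (3 k)
      then show ?thesis using star_in_G2[of k] card_edges_star[of k]
        by (intro bexI[of _ "complete_bipartite 1 k"]) (auto simp: verts_star[of k, simplified])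
    qed
  qed
  then show ?thesis by (simp add: one_ereal_def)
qed

lemma limiting_density_G3: "limiting_density class_G3 = 1"
proof -
  have "limiting_density class_G3 = ereal 1"
  proof (rule limiting_density_eqI[OF minor_closed_graphs[OF minor_closed_G3], where c = 3])
    show "real (card (edges G)) \<le> 1 * real (card (verts G)) + 3" if "G \<in> class_G3" for G
      using class_G3_edges[OF that] by simp
    fix n :: nat
    show "\<exists>G\<in>class_G3. card (verts G) = n \<and> 1 * real n - 3 \<le> real (card (edges G))"
    proof (cases "n = 0")
      case True
      then show ?thesis using empty_graph_in_class[OF minor_closed_G3 path_in_G3[of 1]] by auto
    next
      case False
      then show ?thesis using path_in_G3[of n] card_edges_path[of n]
        by (intro bexI[of _ "path_graph n"]) (auto simp: verts_path)
    qed
  qed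
  then show ?thesis by (simp add: one_ereal_def)
qed

section \<open>Cycles in connected sets\<close>

text \<open>A maximal proper connected subset of a connected set misses exactly one vertex.\<close>

lemma connected_in_remove_vertex:
  assumes S: "connected_in G S" "finite S" "card S \<ge> 2"
  obtains x u where "x \<in> S" "u \<in> S - {x}" "{u, x} \<in> edges G" "connected_in G (S - {x})"
proof -
  let ?C = "{T. T \<subset> S \<and> connected_in G T}"
  obtain v where v: "v \<in> S" using connected_in_nonempty[OF S(1)] by blast
  have "{v} \<noteq> S" using S(3) by auto
  then have "{v} \<in> ?C" using v connected_in_verts[OF S(1)] connected_in_singleton by blast
  moreover have fin: "finite ?C" by (rule finite_subset[of _ "Pow S"]) (use S(2) in auto)
  ultimately have "Max (card ` ?C) \<in> card ` ?C" by (intro Max_in finite_imageI) blast+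
  then obtain T where Tmax: "Max (card ` ?C) = card T" and T: "T \<in> ?C" by (rule imageE)
  have T2: "card T' \<le> card T" if "T' \<in> ?C" for T'
    unfolding Tmax[symmetric] using that fin by (intro Max_ge finite_imageI imageI)
  have "T \<noteq> {}" "T \<subseteq> S" "T \<noteq> S" using T connected_in_nonempty by blast+
  then obtain u x where ux: "u \<in> T" "x \<in> S - T" "{u, x} \<in> edges G"
    by (rule connected_in_cut[OF S(1)])
  have "connected_in G (T \<union> {x})"
    using T ux connected_in_verts[OF S(1)] by (intro connected_in_Un[of G T "{x}" u x] connected_in_singleton) auto
  moreover have "card (T \<union> {x}) > card T"
    using ux T S(2) by (auto simp: card_insert_if finite_subset)
  \<comment> \<open>The enlarged set is connected and bigger than the largest proper connected
    subset, so it is not proper.\<close>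
  ultimately have "T \<union> {x} = S" using T2[of "T \<union> {x}"] T ux by auto
  then have "S - {x} = T" using ux by blast
  then show ?thesis using that[of x u] ux T by auto
qed

text \<open>Removing vertices as above and reading the process backwards builds \<open>S\<close>
  from one vertex by attaching neighbours. This takes the place of a spanning tree in the edge
  counts.\<close>

lemma connected_in_induct [consumes 2, case_names singleton insert]:
  assumes "finite S" "connected_in G S"
    and single: "\<And>v. v \<in> verts G \<Longrightarrow> P {v}"
    and insert: "\<And>T x u. finite T \<Longrightarrow> connected_in G T \<Longrightarrow> x \<in> verts G \<Longrightarrow> x \<notin> T \<Longrightarrow> u \<in> T \<Longrightarrow>
      {u, x} \<in> edges G \<Longrightarrow> P T \<Longrightarrow> P (insert x T)"
  shows "P S"
  using assms(1,2)
proof (induction "card S" arbitrary: S)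
  case 0
  then show ?case using connected_in_nonempty[OF 0(3)] by simp
next
  case (Suc n)
  show ?case
  proof (cases n)
    case 0
    then obtain v where "S = {v}" using Suc by (metis One_nat_def card_1_singletonE)
    then show ?thesis using single connected_in_verts[OF Suc(4)] by simp
  next
    case (Suc m)
    then have "card S \<ge> 2" using \<open>Suc n = card S\<close> by simp
    then obtain x u where xu: "x \<in> S" "u \<in> S - {x}" "{u, x} \<in> edges G" "connected_in G (S - {x})"
      using connected_in_remove_vertex[OF \<open>connected_in G S\<close> \<open>finite S\<close>] by blast
    have "n = card (S - {x})" using \<open>Suc n = card S\<close> xu \<open>finite S\<close> by simp
    then have "P (S - {x})" using Suc.hyps(1) xu \<open>finite S\<close> by simp
    then have "P (insert x (S - {x}))"
      using xu connected_in_verts[OF \<open>connected_in G S\<close>] \<open>finite S\<close> by (intro insert[of "S - {x}" x u]) auto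
    then show ?thesis using xu by (simp add: insert_absorb)
  qed
qed

text \<open>The build-up of \<open>S\<close> passes through every cardinality from 1 to
  \<open>card S\<close>.\<close>

lemma connected_in_subset_card:
  assumes "finite S" "connected_in G S" "1 \<le> k" "k \<le> card S"
  shows "\<exists>T\<subseteq>S. connected_in G T \<and> card T = k"
  using assms
proof (induction rule: connected_in_induct)
  case (singleton v)
  then show ?case using connected_in_singleton by (intro exI[of _ "{v}"]) auto
next
  case (insert T x u)
  show ?case
  proof (cases "k \<le> card T")
    case True
    then show ?thesis using insert by blast
  next
    case False
    then have "k = card (insert x T)" using insert by simp
    moreover have "connected_in G (T \<union> {x})"
      using insert by (intro connected_in_Un[of G T "{x}" u x] connected_in_singleton) auto
    ultimately show ?thesis by (intro exI[of _ "insert x T"]) simp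
  qed
qed

lemma edges_induce: "edges (induce G S) = {e \<in> edges G. e \<subseteq> S}"
  unfolding induce_def by simp

lemma card_edges_induce_insert:
  assumes G: "is_graph G" and x: "x \<notin> T"
  shows "card (edges (induce G (insert x T))) = card (edges (induce G T)) + card {u \<in> T. {u, x} \<in> edges G}"
proof -
  let ?N = "{u \<in> T. {u, x} \<in> edges G}"
  have eq: "edges (induce G (insert x T)) = edges (induce G T) \<union> (\<lambda>u. {u, x}) ` ?N"
  proof (intro equalityI subsetI)
    fix e assume e: "e \<in> edges (induce G (insert x T))"
    then have e': "e \<in> edges G" "e \<subseteq> insert x T" by (auto simp: edges_induce)
    obtain a b where ab: "e = {a, b}" "a \<noteq> b" using edgeE[OF G e'(1)] by blast
    show "e \<in> edges (induce G T) \<union> (\<lambda>u. {u, x}) ` ?N"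
    proof (cases "x \<in> e")
      case True
      then obtain u where "e = {u, x}" "u \<noteq> x" using ab by blast
      then show ?thesis using e' by blast
    qed (use e' in \<open>auto simp: edges_induce\<close>)
  qed (auto simp: edges_induce)
  have fin: "finite (edges (induce G T))" "finite ?N"
  proof -
    show "finite (edges (induce G T))" using finite_edges[OF G] by (simp add: edges_induce)
    have "?N \<subseteq> verts G" using graph_edge_verts[OF G] by blast
    then show "finite ?N" using G unfolding is_graph_def by (meson finite_subset)
  qed
  have "inj_on (\<lambda>u. {u, x}) ?N" by (auto intro!: inj_onI simp: doubleton_eq_iff)
  moreover have "edges (induce G T) \<inter> (\<lambda>u. {u, x}) ` ?N = {}" using x by (auto simp: edges_induce)
  ultimately show ?thesis unfolding eq using fin by (simp add: card_Un_disjoint card_image)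
qed

text \<open>Every attached vertex brings at least one edge.\<close>

lemma connected_in_card_le_edges:
  assumes G: "is_graph G" and "finite S" "connected_in G S"
  shows "card S \<le> card (edges (induce G S)) + 1"
  using assms(2,3)
proof (induction rule: connected_in_induct)
  case (insert T x u)
  let ?N = "{u \<in> T. {u, x} \<in> edges G}"
  have "u \<in> ?N" "finite ?N" using insert by auto
  then have "card ?N \<ge> 1" by (metis One_nat_def Suc_leI card_gt_0_iff empty_iff)
  then show ?case using insert card_edges_induce_insert[OF G, of x T] by simp
qed simp

text \<open>A model of a \<open>K_3\<close> minor inside \<open>S\<close>, with explicit branch sets
  \<open>T 0\<close>, \<open>T 1\<close>, \<open>T 2\<close>, so that models in different components
  can be assembled into one of \<open>k\<close> triangles.\<close>

definition triangle_in :: "graph \<Rightarrow> nat set \<Rightarrow> (nat \<Rightarrow> nat set) \<Rightarrow> bool" where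
  "triangle_in G S T \<longleftrightarrow> (\<forall>a<3. connected_in G (T a) \<and> T a \<subseteq> S) \<and>
     (\<forall>a<3. \<forall>b<3. a \<noteq> b \<longrightarrow> T a \<inter> T b = {} \<and> (\<exists>u\<in>T a. \<exists>v\<in>T b. {u, v} \<in> edges G))"

lemma triangle_inI:
  assumes conn: "connected_in G A" "connected_in G B" "connected_in G C"
    and sub: "A \<subseteq> S" "B \<subseteq> S" "C \<subseteq> S"
    and disj: "A \<inter> B = {}" "A \<inter> C = {}" "B \<inter> C = {}"
    and adj: "u \<in> A" "v \<in> B" "{u, v} \<in> edges G" "u' \<in> A" "w \<in> C" "{u', w} \<in> edges G"
      "v' \<in> B" "w' \<in> C" "{v', w'} \<in> edges G"
  shows "\<exists>T. triangle_in G S T"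
proof (rule exI[of _ "\<lambda>a. if a = 0 then A else if a = 1 then B else C"], unfold triangle_in_def, intro conjI allI impI)
  let ?T = "\<lambda>a::nat. if a = 0 then A else if a = 1 then B else C"
  fix a b :: nat
  show "connected_in G (?T a)" "?T a \<subseteq> S" using conn sub by auto
  assume "a < 3" "b < 3" "a \<noteq> b"
  moreover from this have "a \<in> {0, 1, 2}" "b \<in> {0, 1, 2}" by auto
  ultimately consider "a = 0" "b = 1" | "a = 0" "b = 2" | "a = 1" "b = 0" | "a = 1" "b = 2" | "a = 2" "b = 0" | "a = 2" "b = 1"
    by blast
  then show "?T a \<inter> ?T b = {}" "\<exists>u\<in>?T a. \<exists>v\<in>?T b. {u, v} \<in> edges G"
    using disj adj by (cases; simp; metis insert_commute Int_commute)+
qed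

text \<open>Every attached vertex brings at most one edge: two neighbours in the connected set
  \<open>T\<close> would close a cycle through \<open>x\<close> and hence give a triangle
  minor.\<close>

lemma connected_in_edges_lt_card:
  assumes G: "is_graph G" and "finite S" "connected_in G S" "\<nexists>T. triangle_in G S T"
  shows "card (edges (induce G S)) + 1 \<le> card S"
  using assms(2-)
proof (induction rule: connected_in_induct)
  case (singleton v)
  have "edges (induce G {v}) = {}"
    using G unfolding is_graph_def edges_induce by (force simp: subset_singleton_iff)
  then show ?case by simp
next
  case (insert T x u)
  let ?N = "{u \<in> T. {u, x} \<in> edges G}"
  have "\<nexists>T'. triangle_in G T T'" using insert.prems unfolding triangle_in_def by blast
  then have IH: "card (edges (induce G T)) + 1 \<le> card T" by (rule insert.IH)
  have uniq: "a = b" if a: "a \<in> ?N" and b: "b \<in> ?N" for a b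
  proof (rule ccontr)
    assume ab: "a \<noteq> b"
    \<comment> \<open>The union of \<open>?F\<close> is the component of \<open>a\<close> in
      \<open>T - {b}\<close>. Together with \<open>{b}\<close> and \<open>{x}\<close> it will form
      the triangle; only its adjacency to \<open>b\<close> is in question.\<close>
    let ?F = "{A. connected_in G A \<and> a \<in> A \<and> A \<subseteq> T - {b}}"
    let ?A = "\<Union>?F"
    have TV: "T \<subseteq> verts G" using connected_in_verts[OF insert.hyps(2)] .
    have aF: "{a} \<in> ?F" using a ab TV connected_in_singleton by blast
    then have A: "connected_in G ?A" by (intro connected_in_Union_common[of ?F G a]) auto
    have aA: "a \<in> ?A" using aF by blast
    have "?A \<noteq> {}" "?A \<subseteq> T" "?A \<noteq> T" using aA b by blast+
    then obtain w y where wy: "w \<in> ?A" "y \<in> T - ?A" "{w, y} \<in> edges G"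
      by (rule connected_in_cut[OF insert.hyps(2)])
    \<comment> \<open>Some edge leaves \<open>?A\<close> inside the connected set \<open>T\<close>;
      an end other than \<open>b\<close> could be added to \<open>?A\<close>.\<close>
    have "y = b"
    proof (rule ccontr)
      assume "y \<noteq> b"
      have "connected_in G (?A \<union> {y})"
        using A wy TV by (intro connected_in_Un[of G ?A "{y}" w y] connected_in_singleton) auto
      then have "?A \<union> {y} \<in> ?F" using aA wy(2) \<open>y \<noteq> b\<close> by blast
      then have "y \<in> ?A" by blast
      with wy(2) show False by blast
    qed
    have "\<exists>T'. triangle_in G (insert x T) T'"
    proof (rule triangle_inI)
      show "connected_in G ?A" by (rule A)
      show "connected_in G {b}" "connected_in G {x}" using b TV insert.hyps by (auto intro: connected_in_singleton)
      show "?A \<inter> {b} = {}" "?A \<inter> {x} = {}" "{b} \<inter> {x} = {}" using b insert.hyps by auto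
      show "?A \<subseteq> insert x T" "{b} \<subseteq> insert x T" "{x} \<subseteq> insert x T" using b by auto
      show "w \<in> ?A" "b \<in> {b}" "{w, b} \<in> edges G" using wy \<open>y = b\<close> by auto
      show "a \<in> ?A" "x \<in> {x}" "{a, x} \<in> edges G" using a aA by auto
      show "b \<in> {b}" "x \<in> {x}" "{b, x} \<in> edges G" using b by auto
    qed
    with insert.prems show False by blast
  qed
  have "finite ?N" using insert.hyps(1) by simp
  then have "card ?N \<le> 1"
    unfolding One_nat_def by (rule card_le_Suc0_iff_eq[THEN iffD2]) (intro ballI uniq)
  then show ?case using IH card_edges_induce_insert[OF G insert.hyps(4)] insert.hyps by simp
qed

section \<open>Components\<close>

text \<open>As a union of connected sets through \<open>v\<close>, the component is connected by the
  common-vertex lemma and maximal by construction.\<close>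

definition component :: "graph \<Rightarrow> nat \<Rightarrow> nat set" where
  "component G v = \<Union>{A. connected_in G A \<and> v \<in> A}"

definition components_of :: "graph \<Rightarrow> nat set set" where
  "components_of G = component G ` verts G"

lemma component_self: "v \<in> verts G \<Longrightarrow> v \<in> component G v"
  unfolding component_def using connected_in_singleton by blast

lemma connected_in_component: "v \<in> verts G \<Longrightarrow> connected_in G (component G v)"
  unfolding component_def
  by (rule connected_in_Union_common[where v = v]) (use connected_in_singleton in blast)+

lemma connected_in_subset_component: "connected_in G A \<Longrightarrow> v \<in> A \<Longrightarrow> A \<subseteq> component G v"
  unfolding component_def by blast

lemma component_eq:
  assumes u: "u \<in> verts G" and v: "v \<in> component G u"
  shows "component G v = component G u"
proof
  have vV: "v \<in> verts G" using v connected_in_verts[OF connected_in_component[OF u]] by blast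
  show "component G u \<subseteq> component G v"
    by (rule connected_in_subset_component[OF connected_in_component[OF u] v])
  then have "u \<in> component G v" using component_self[OF u] by blast
  then show "component G v \<subseteq> component G u"
    by (rule connected_in_subset_component[OF connected_in_component[OF vV]])
qed

lemma components_of_connected: "S \<in> components_of G \<Longrightarrow> connected_in G S"
  unfolding components_of_def using connected_in_component by blast

lemma components_of_disjoint:
  assumes "S \<in> components_of G" "S' \<in> components_of G" "S \<noteq> S'"
  shows "S \<inter> S' = {}"
  using assms component_eq unfolding components_of_def by blast

lemma Union_components_of: "\<Union>(components_of G) = verts G"
proof
  show "\<Union>(components_of G) \<subseteq> verts G"
    by (rule Union_least) (rule connected_in_verts[OF components_of_connected])
  show "verts G \<subseteq> \<Union>(components_of G)"
    unfolding components_of_def by (auto intro: component_self)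
qed

lemma finite_components_of: "is_graph G \<Longrightarrow> finite (components_of G)"
  unfolding components_of_def is_graph_def by blast

lemma finite_connected_in: "is_graph G \<Longrightarrow> connected_in G S \<Longrightarrow> finite S"
  using connected_in_verts unfolding is_graph_def by (metis finite_subset)

lemma sum_card_components:
  assumes "is_graph G"
  shows "(\<Sum>S\<in>components_of G. card S) = card (verts G)"
  unfolding Union_components_of[symmetric]
  by (rule card_Union_disjoint[symmetric])
    (use assms components_of_disjoint components_of_connected finite_connected_in
      in \<open>auto simp: pairwise_def disjnt_def\<close>)

lemma card_edges_le_components:
  assumes G: "is_graph G"
  shows "card (edges G) \<le> (\<Sum>S\<in>components_of G. card (edges (induce G S)))"
proof -
  have "e \<in> (\<Union>S\<in>components_of G. edges (induce G S))" if e: "e \<in> edges G" for e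
  proof -
    obtain x y where xy: "e = {x, y}" "x \<in> verts G" "y \<in> verts G" using edgeE[OF G e] by blast
    have "connected_in G ({x} \<union> {y})"
      using xy e by (intro connected_in_Un[of G "{x}" "{y}" x y] connected_in_singleton) auto
    then have "e \<subseteq> component G x" using connected_in_subset_component[of G "{x} \<union> {y}" x] xy by simp
    then show ?thesis using e xy unfolding components_of_def by (auto simp: edges_induce)
  qed
  then have "edges G \<subseteq> (\<Union>S\<in>components_of G. edges (induce G S))" by blast
  then have "card (edges G) \<le> card (\<Union>S\<in>components_of G. edges (induce G S))"
    using finite_components_of[OF G] finite_edges[OF G] by (intro card_mono) (auto simp: edges_induce)
  also have "\<dots> \<le> (\<Sum>S\<in>components_of G. card (edges (induce G S)))"
    by (rule card_UN_le[OF finite_components_of[OF G]])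
  finally show ?thesis .
qed

section \<open>Classes omitting all three obstructions\<close>

lemma star_minor_of_degree:
  assumes G: "is_graph G" and x: "x \<in> verts G" and D: "D \<le> card {y. {x, y} \<in> edges G}"
  shows "is_minor (complete_bipartite 1 D) G"
proof -
  obtain N where N: "N \<subseteq> {y. {x, y} \<in> edges G}" "card N = D" "finite N"
    by (rule obtain_subset_with_card_n[OF D])
  have NV: "N \<subseteq> verts G" "x \<notin> N" using N(1) graph_edge_verts[OF G] by blast+
  obtain f where f: "bij_betw f {1..D} N"
    using N(2,3) by (metis bij_betw_iff_card card_atLeastAtMost diff_Suc_1 finite_atLeastAtMost)
  have fN: "f j \<in> N" if "j \<in> {1..D}" for j using f that by (meson bij_betwE)
  let ?g = "\<lambda>j. if j = 0 then x else f j"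
  show ?thesis
  proof (rule is_minor_inj[OF is_graph_star, where f = ?g])
    show "?g ` verts (complete_bipartite 1 D) \<subseteq> verts G"
      using fN x NV by (auto simp: verts_star[simplified])
    show "inj_on ?g (verts (complete_bipartite 1 D))"
    proof (rule inj_onI)
      fix i j assume ij: "i \<in> verts (complete_bipartite 1 D)" "j \<in> verts (complete_bipartite 1 D)" "?g i = ?g j"
      then have *: "k = 0 \<or> k \<in> {1..D}" if "k \<in> {i, j}" for k using that unfolding verts_star by auto
      show "i = j"
      proof (cases "i = 0 \<or> j = 0")
        case True
        then show ?thesis using ij(3) fN[of i] fN[of j] *[of i] *[of j] NV(2) by (auto split: if_splits)
      next
        case False
        then have "i \<in> {1..D}" "j \<in> {1..D}" "f i = f j" using * ij(3) by auto
        then show ?thesis using f unfolding bij_betw_def by (metis inj_onD)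
      qed
    qed
    fix i j assume e: "{i, j} \<in> edges (complete_bipartite 1 D)"
    have "{x, f l} \<in> edges G" if "l \<in> {1..D}" for l using fN[OF that] N(1) by blast
    then show "{?g i, ?g j} \<in> edges G" using e unfolding edge_star by (auto simp: insert_commute)
  qed
qed

text \<open>A shortest walk is a path.\<close>

lemma path_minor_of_shortest_walk:
  fixes G S
  defines "R \<equiv> {(x, y). x \<in> S \<and> y \<in> S \<and> {x, y} \<in> edges G}"
  assumes S: "S \<subseteq> verts G" and v: "v \<in> S"
    and w: "(v, w) \<in> R ^^ n" and least: "\<And>m. (v, w) \<in> R ^^ m \<Longrightarrow> n \<le> m" and p: "p \<le> Suc n"
  shows "is_minor (path_graph p) G"
proof -
  obtain f where f: "f 0 = v" "f n = w" "\<And>i. i < n \<Longrightarrow> (f i, f (Suc i)) \<in> R"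
    using w unfolding relpow_fun_conv by blast
  have walk: "(f i, f (i + k)) \<in> R ^^ k" if "i + k \<le> n" for i k
    using that
  proof (induction k)
    case (Suc k)
    then show ?case using f(3)[of "i + k"] by (auto intro: relpow_Suc_I)
  qed simp
  \<comment> \<open>A repeated vertex would allow the part of the walk between its occurrences to be
    cut out, against minimality of \<open>n\<close>.\<close>
  have ne: False if "f i = f j" "i < j" "j \<le> n" for i j
  proof -
    have "(f 0, f i) \<in> R ^^ i" "(f j, f n) \<in> R ^^ (n - j)"
      using walk[of 0 i] walk[of j "n - j"] that by auto
    then have "(v, w) \<in> R ^^ (i + (n - j))"
      unfolding relpow_add using f that by auto
    then show False using least[of "i + (n - j)"] that by auto
  qed
  have fS: "f i \<in> S" if "i \<le> n" for i
  proof (cases i)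
    case 0 then show ?thesis using f v by simp
  next
    case (Suc j) then show ?thesis using f(3)[of j] that unfolding R_def by auto
  qed
  show ?thesis
  proof (rule is_minor_inj[OF is_graph_path, where f = f])
    show "f ` verts (path_graph p) \<subseteq> verts G" using fS S p unfolding verts_path by fastforce
    show "inj_on f (verts (path_graph p))"
    proof (rule inj_onI)
      fix i j assume "i \<in> verts (path_graph p)" "j \<in> verts (path_graph p)" "f i = f j"
      then show "i = j" using ne[of i j] ne[of j i] p unfolding verts_path by fastforce
    qed
    fix i j assume "{i, j} \<in> edges (path_graph p)"
    then show "{f i, f j} \<in> edges G"
      using f(3)[of i] f(3)[of j] p unfolding edge_path R_def by (auto simp: insert_commute)
  qed
qed

text \<open>Breadth-first search from a vertex of \<open>S\<close>: degrees are at most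
  \<open>D\<close>, so at most \<open>D ^ i\<close> vertices end a walk of length \<open>i\<close>,
  and a vertex at distance \<open>p\<close> or more would yield a path on \<open>p\<close>
  vertices.\<close>

lemma card_connected_le:
  assumes G: "is_graph G" and S: "connected_in G S"
    and star: "\<not> is_minor (complete_bipartite 1 D) G" and path: "\<not> is_minor (path_graph p) G"
  shows "card S \<le> (\<Sum>i<p. D ^ i)"
proof -
  define R where "R = {(x, y). x \<in> S \<and> y \<in> S \<and> {x, y} \<in> edges G}"
  have finS: "finite S" by (rule finite_connected_in[OF G S])
  have SV: "S \<subseteq> verts G" by (rule connected_in_verts[OF S])
  have deg: "finite (R `` {x})" "card (R `` {x}) \<le> D" for x
  proof -
    have "R `` {x} \<subseteq> S" unfolding R_def by blast
    then show "finite (R `` {x})" using finS by (rule finite_subset)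
    show "card (R `` {x}) \<le> D"
    proof (cases "x \<in> S")
      case True
      have fin: "finite {y. {x, y} \<in> edges G}"
        by (rule finite_subset[of _ "verts G"]) (use graph_edge_verts[OF G] G in \<open>auto simp: is_graph_def\<close>)
      have "card {y. {x, y} \<in> edges G} \<le> D"
        using star_minor_of_degree[OF G, of x D] star True SV by (meson nat_le_linear subsetD)
      moreover have "card (R `` {x}) \<le> card {y. {x, y} \<in> edges G}"
        using fin by (rule card_mono) (auto simp: R_def)
      ultimately show ?thesis by simp
    next
      case False
      then have "R `` {x} = {}" unfolding R_def by blast
      then show ?thesis by simp
    qed
  qed
  obtain v where v: "v \<in> S" using connected_in_nonempty[OF S] by blast
  have lev: "finite ((R ^^ i) `` {v}) \<and> card ((R ^^ i) `` {v}) \<le> D ^ i" for i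
  proof (induction i)
    case (Suc i)
    let ?L = "(R ^^ i) `` {v}"
    have eq: "(R ^^ Suc i) `` {v} = (\<Union>x\<in>?L. R `` {x})" by auto
    have "card (\<Union>x\<in>?L. R `` {x}) \<le> (\<Sum>x\<in>?L. card (R `` {x}))"
      using Suc by (intro card_UN_le) simp
    also have "\<dots> \<le> card ?L * D" using sum_bounded_above[of ?L "\<lambda>x. card (R `` {x})" D] deg by simp
    also have "\<dots> \<le> D ^ i * D" using Suc by (intro mult_right_mono) auto
    finally show ?case unfolding eq using Suc deg by (simp add: mult.commute)
  qed simp
  have "S \<subseteq> (\<Union>i<p. (R ^^ i) `` {v})"
  proof
    fix w assume w: "w \<in> S"
    then have "(v, w) \<in> R\<^sup>*" using S v unfolding connected_in_def R_def by blast
    then have ex: "\<exists>n. (v, w) \<in> R ^^ n" by (simp add: rtrancl_power)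
    define n where "n = (LEAST n. (v, w) \<in> R ^^ n)"
    have n: "(v, w) \<in> R ^^ n" "\<And>m. (v, w) \<in> R ^^ m \<Longrightarrow> n \<le> m"
      unfolding n_def by (rule LeastI_ex[OF ex], rule Least_le)
    have "n < p"
    proof (rule ccontr)
      assume "\<not> n < p"
      then have "is_minor (path_graph p) G"
        using path_minor_of_shortest_walk[OF SV v, of w n p] n unfolding R_def by simp
      with path show False ..
    qed
    then show "w \<in> (\<Union>i<p. (R ^^ i) `` {v})" using n(1) by blast
  qed
  then have "card S \<le> card (\<Union>i<p. (R ^^ i) `` {v})" using lev by (intro card_mono) auto
  also have "\<dots> \<le> (\<Sum>i<p. card ((R ^^ i) `` {v}))" by (rule card_UN_le) simp
  also have "\<dots> \<le> (\<Sum>i<p. D ^ i)" using lev by (intro sum_mono) auto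
  finally show ?thesis .
qed

text \<open>The triangles are placed in \<open>k\<close> different components; disjointness within a
  copy comes from \<open>triangle_in\<close>, between copies from that of the components.\<close>

lemma triangles_minor_of_components:
  assumes G: "is_graph G" and k: "k \<le> card {S \<in> components_of G. \<exists>T. triangle_in G S T}"
  shows "is_minor (copies k (complete_graph 3)) G"
proof -
  let ?C = "{S \<in> components_of G. \<exists>T. triangle_in G S T}"
  obtain C where C: "C \<subseteq> ?C" "card C = k" "finite C" by (rule obtain_subset_with_card_n[OF k])
  then obtain h where h: "bij_betw h {..<k} C"
    using C(2) by (metis bij_betw_iff_card card_lessThan finite_lessThan)
  have hC: "h i \<in> ?C" if "i < k" for i using h C(1) that by (meson bij_betwE lessThan_iff subsetD)
  define t where "t S = (SOME T. triangle_in G S T)" for S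
  have t: "triangle_in G (h i) (t (h i))" if "i < k" for i
  proof -
    have "\<exists>T. triangle_in G (h i) T" using hC[OF that] by blast
    then show ?thesis unfolding t_def by (rule someI_ex)
  qed
  \<comment> \<open>The label \<open>u\<close> is decoded into a copy \<open>i\<close> and a
    triangle vertex \<open>a\<close>; its branch set is the \<open>a\<close>-th one in the component
    \<open>h i\<close>.\<close>
  define B where "B u = t (h (fst (prod_decode u))) (snd (prod_decode u))" for u
  have B: "B (prod_encode (i, a)) = t (h i) a" for i a unfolding B_def by simp
  show ?thesis
  proof (rule is_minorI[where B = B])
    fix u assume "u \<in> verts (copies k (complete_graph 3))"
    then obtain i a where "i < k" "a < 3" "u = prod_encode (i, a)"
      unfolding verts_copies complete_graph_def by auto
    then show "connected_in G (B u)" using t unfolding B triangle_in_def by (simp add: B)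
  next
    fix u v assume u: "u \<in> verts (copies k (complete_graph 3))"
      and v: "v \<in> verts (copies k (complete_graph 3))" and "u \<noteq> v"
    from u obtain i a where ia: "i < k" "a < 3" "u = prod_encode (i, a)"
      unfolding verts_copies complete_graph_def by auto
    from v obtain j b where jb: "j < k" "b < 3" "v = prod_encode (j, b)"
      unfolding verts_copies complete_graph_def by auto
    show "B u \<inter> B v = {}"
    proof (cases "i = j")
      case True
      then have "a \<noteq> b" using ia jb \<open>u \<noteq> v\<close> by auto
      then show ?thesis using t[OF ia(1)] True ia jb unfolding triangle_in_def by (simp add: B)
    next
      case False
      then have "h i \<noteq> h j" using h ia jb unfolding bij_betw_def by (meson inj_onD lessThan_iff)
      then have "h i \<inter> h j = {}" using components_of_disjoint hC ia jb by blast
      moreover have "B u \<subseteq> h i" "B v \<subseteq> h j"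
        using t[OF ia(1)] t[OF jb(1)] ia jb unfolding triangle_in_def by (simp_all add: B)
      ultimately show ?thesis by blast
    qed
  next
    fix u v assume "{u, v} \<in> edges (copies k (complete_graph 3))"
    then obtain i a b where "i < k" "a < 3" "b < 3" "a \<noteq> b" "u = prod_encode (i, a)" "v = prod_encode (i, b)"
      unfolding edge_triangles by blast
    then show "\<exists>x\<in>B u. \<exists>y\<in>B v. {x, y} \<in> edges G"
      using t[of i] unfolding triangle_in_def by (simp add: B)
  qed
qed

text \<open>A crude bound by the number of all subsets; only its uniformity matters, since it is
  applied to boundedly many components.\<close>

lemma card_edges_induce_le:
  assumes "finite S" "card S \<le> m"
  shows "card (edges (induce G S)) \<le> 2 ^ m"
proof -
  have "card (edges (induce G S)) \<le> card (Pow S)"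
    using assms by (intro card_mono) (auto simp: edges_induce)
  also have "\<dots> = 2 ^ card S" by (rule card_Pow[OF assms(1)])
  also have "\<dots> \<le> 2 ^ m" using assms by simp
  finally show ?thesis .
qed

section \<open>The density of an infinite class omitting all three obstructions\<close>

lemma limiting_density_omitting:
  assumes mc: "minor_closed_class \<G>" and inf: "infinite (\<G> // graph_iso)"
    and tri: "copies k (complete_graph 3) \<notin> \<G>"
    and star: "complete_bipartite 1 D \<notin> \<G>" and path: "path_graph p \<notin> \<G>"
  shows "limiting_density \<G> < 1"
proof -
  have gr: "is_graph G" if "G \<in> \<G>" for G using minor_closed_graphs[OF mc] that by blast
  have omit: "\<not> is_minor H G" if "G \<in> \<G>" "is_graph H" "H \<notin> \<G>" for G H
    using mc that unfolding minor_closed_class_def by blast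
  define M where "M = (\<Sum>i<p. D ^ i)"
  have cM: "card S \<le> M" if "G \<in> \<G>" "S \<in> components_of G" for G S
    unfolding M_def
    by (rule card_connected_le[OF gr[OF that(1)] components_of_connected[OF that(2)]
      omit[OF that(1) is_graph_star star] omit[OF that(1) is_graph_path path]])
  have cc: "card {S \<in> components_of G. \<exists>T. triangle_in G S T} \<le> k" if "G \<in> \<G>" for G
    using triangles_minor_of_components[OF gr[OF that]] omit[OF that is_graph_triangles tri]
    by (meson nat_le_linear)
  have finc: "finite S" if "G \<in> \<G>" "S \<in> components_of G" for G S
    using finite_connected_in[OF gr components_of_connected] that by blast
  have c1: "1 \<le> card S" if "G \<in> \<G>" "S \<in> components_of G" for G S
    using finc[OF that] connected_in_nonempty[OF components_of_connected[OF that(2)]]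
    by (simp add: Suc_le_eq card_gt_0_iff)
  define P where "P j \<longleftrightarrow> (\<forall>N. \<exists>G\<in>\<G>. N \<le> card {S \<in> components_of G. j \<le> card S})" for j
  \<comment> \<open>An infinite class has members of arbitrarily large order; as components have at
    most \<open>M\<close> vertices, there are arbitrarily many of them.\<close>
  have P1: "P 1"
    unfolding P_def
  proof
    fix N
    obtain G where G: "G \<in> \<G>" "\<not> card (verts G) \<le> N * M"
      using finite_iso_classes[OF minor_closed_graphs[OF mc], of "N * M"] inf by blast
    have "card (verts G) \<le> card (components_of G) * M"
      unfolding sum_card_components[OF gr[OF G(1)], symmetric]
      using sum_bounded_above[of "components_of G" card M] cM[OF G(1)] by simp
    with G(2) have "N * M < card (components_of G) * M" by linarith
    then have "N \<le> card (components_of G)" by simp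
    moreover have "{S \<in> components_of G. 1 \<le> card S} = components_of G" using c1[OF G(1)] by blast
    ultimately show "\<exists>G\<in>\<G>. N \<le> card {S \<in> components_of G. 1 \<le> card S}" using G(1) by metis
  qed
  have PM: "j \<le> M" if "P j" for j
  proof -
    obtain G where G: "G \<in> \<G>" "1 \<le> card {S \<in> components_of G. j \<le> card S}"
      using \<open>P j\<close> unfolding P_def by blast
    then obtain S where "S \<in> components_of G" "j \<le> card S"
      by (metis (no_types, lifting) card.empty empty_Collect_eq not_one_le_zero)
    then show ?thesis using cM[OF G(1)] le_trans by blast
  qed
  define s where "s = (GREATEST j. P j)"
  have Ps: "P s" unfolding s_def by (rule GreatestI_nat[of P, OF P1 PM])
  have s1: "1 \<le> s" unfolding s_def by (rule Greatest_le_nat[of P, OF P1 PM])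
  \<comment> \<open>Maximality of \<open>s\<close> yields the uniform bound \<open>K\<close> on the
    number of components with more than \<open>s\<close> vertices.\<close>
  have "\<not> P (Suc s)"
    using Greatest_le_nat[of P "Suc s" M] PM unfolding s_def by auto
  then obtain K where K: "\<And>G. G \<in> \<G> \<Longrightarrow> card {S \<in> components_of G. Suc s \<le> card S} \<le> K"
    unfolding P_def by (meson nat_le_linear)
  define a where "a = 1 - 1 / real s"
  \<comment> \<open>The summand \<open>s\<close> pays for the remainder of \<open>n\<close> modulo
    \<open>s\<close> in the lower bound; the other one pays for at most \<open>K + k\<close>
    exceptional components, with at most \<open>2 ^ M\<close> edges each, in the upper
    bound.\<close>
  define c where "c = real s + 2 ^ M * real (K + k)"
  have a: "0 \<le> a" "a \<le> 1" unfolding a_def using s1 by (auto simp: field_simps)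
  have "limiting_density \<G> = ereal a"
  proof (rule limiting_density_eqI[OF minor_closed_graphs[OF mc], where c = c])
    fix G assume G: "G \<in> \<G>"
    let ?C = "components_of G"
    let ?X = "{S \<in> ?C. Suc s \<le> card S} \<union> {S \<in> ?C. \<exists>T. triangle_in G S T}"
    have finC: "finite ?C" by (rule finite_components_of[OF gr[OF G]])
    have e: "real (card (edges (induce G S))) \<le> a * real (card S) + (if S \<in> ?X then 2 ^ M else 0)"
      if S: "S \<in> ?C" for S
    proof (cases "S \<in> ?X")
      case True
      have "card (edges (induce G S)) \<le> 2 ^ M"
        by (rule card_edges_induce_le[OF finc[OF G S] cM[OF G S]])
      then have "real (card (edges (induce G S))) \<le> 2 ^ M"
        by (metis of_nat_le_iff of_nat_numeral of_nat_power)
      moreover have "0 \<le> a * real (card S)" using a by simp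
      ultimately show ?thesis unfolding if_P[OF True] by linarith
    next
      case False
      then have "\<nexists>T. triangle_in G S T" and le: "card S \<le> s" using S by auto
      then have "card (edges (induce G S)) + 1 \<le> card S"
        by (intro connected_in_edges_lt_card[OF gr[OF G] finc[OF G S] components_of_connected[OF S]])
      then have "real (card (edges (induce G S))) \<le> real (card S) - 1" by linarith
      \<comment> \<open>With \<open>a = 1 - 1 / s\<close> this says
        \<open>card S / s \<le> 1\<close>.\<close>
      also have "\<dots> \<le> a * real (card S)" unfolding a_def using s1 le by (simp add: field_simps)
      finally show ?thesis using False by auto
    qed
    have "real (card (edges G)) \<le> real (\<Sum>S\<in>?C. card (edges (induce G S)))"
      using card_edges_le_components[OF gr[OF G]] by (simp only: of_nat_le_iff)
    also have "\<dots> = (\<Sum>S\<in>?C. real (card (edges (induce G S))))" by simp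
    also have "\<dots> \<le> (\<Sum>S\<in>?C. a * real (card S) + (if S \<in> ?X then 2 ^ M else 0))"
      by (rule sum_mono) (rule e)
    also have "\<dots> = a * real (\<Sum>S\<in>?C. card S) + (\<Sum>S\<in>?C. if S \<in> ?X then 2 ^ M else 0)"
      by (simp only: sum.distrib of_nat_sum sum_distrib_left)
    also have "(\<Sum>S\<in>?C. if S \<in> ?X then 2 ^ M else 0) = (\<Sum>S\<in>?C \<inter> ?X. (2::real) ^ M)"
      by (rule sum.inter_restrict[symmetric, OF finC])
    also have "?C \<inter> ?X = ?X" by blast
    also have "(\<Sum>S\<in>?X. (2::real) ^ M) = 2 ^ M * real (card ?X)" by simp
    also have "real (card ?X) \<le> real (K + k)"
      using card_Un_le[of "{S \<in> ?C. Suc s \<le> card S}" "{S \<in> ?C. \<exists>T. triangle_in G S T}"] K[OF G] cc[OF G]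
      by linarith
    finally show "real (card (edges G)) \<le> a * real (card (verts G)) + c"
      unfolding c_def sum_card_components[OF gr[OF G]] by (simp add: mult_left_mono)
  next
    fix n :: nat
    \<comment> \<open>Only \<open>n div s\<close> components are used below, but \<open>n\<close> of
      them are requested: then \<open>G\<close> has at least \<open>n\<close> vertices, which leaves
      room to pad the chosen pieces to order exactly \<open>n\<close>.\<close>
    obtain G where G: "G \<in> \<G>" "n \<le> card {S \<in> components_of G. s \<le> card S}"
      using Ps unfolding P_def by blast
    let ?C = "{S \<in> components_of G. s \<le> card S}"
    have finV: "finite (verts G)" using gr[OF G(1)] unfolding is_graph_def by blast
    have "n div s \<le> card ?C" using G(2) div_le_dividend le_trans by blast
    then obtain C where C: "C \<subseteq> ?C" "card C = n div s" and finCC: "finite C"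
      by (rule obtain_subset_with_card_n)
    have "\<exists>T\<subseteq>S. connected_in G T \<and> card T = s" if "S \<in> C" for S
    proof -
      have S: "S \<in> components_of G" "s \<le> card S" using that C(1) by auto
      show ?thesis
        by (rule connected_in_subset_card[OF finc[OF G(1) S(1)] components_of_connected[OF S(1)] s1 S(2)])
    qed
    then obtain t where t: "\<And>S. S \<in> C \<Longrightarrow> t S \<subseteq> S \<and> connected_in G (t S) \<and> card (t S) = s" by metis
    have fint: "finite (t S)" if "S \<in> C" for S using t[OF that] finite_connected_in[OF gr[OF G(1)]] by blast
    have disj: "t S \<inter> t S' = {}" if "S \<in> C" "S' \<in> C" "S \<noteq> S'" for S S'
    proof -
      have "S \<inter> S' = {}" using components_of_disjoint[of S G S'] that C(1) by blast
      then show ?thesis using t[OF that(1)] t[OF that(2)] by blast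
    qed
    let ?U = "\<Union>S\<in>C. t S"
    have UV: "?U \<subseteq> verts G" using t connected_in_verts by blast
    have "card ?U = (\<Sum>S\<in>C. card (t S))" using finCC fint disj by (intro card_UN_disjoint) auto
    also have "\<dots> = n div s * s" using t C(2) by simp
    finally have cU: "card ?U = n div s * s" .
    then have "card ?U \<le> n" by simp
    moreover have "n \<le> card (verts G)"
    proof -
      have "n \<le> card (components_of G)"
        using G(2) card_mono[OF finite_components_of[OF gr[OF G(1)]], of ?C] by auto
      also have "\<dots> \<le> card (verts G)"
        unfolding components_of_def by (rule card_image_le[OF finV])
      finally show ?thesis .
    qed
    \<comment> \<open>Padding vertices can only add edges, so the count on the pieces
      \<open>t S\<close> remains a lower bound.\<close>
    ultimately obtain W where W: "?U \<subseteq> W" "W \<subseteq> verts G" "card W = n"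
      using exists_subset_between[OF _ _ UV finV] by blast
    have eW: "finite (edges (induce G W))" by (rule finite_edges[OF is_graph_induce[OF gr[OF G(1)] W(2)]])
    have "n div s * (s - 1) \<le> (\<Sum>S\<in>C. card (edges (induce G (t S))))"
    proof -
      have "s - 1 \<le> card (edges (induce G (t S)))" if "S \<in> C" for S
        using connected_in_card_le_edges[OF gr[OF G(1)] fint[OF that]] t[OF that] by fastforce
      then show ?thesis using sum_bounded_below[of C "s - 1" "\<lambda>S. card (edges (induce G (t S)))"] C(2) by simp
    qed
    also have "\<dots> = card (\<Union>S\<in>C. edges (induce G (t S)))"
    proof (rule card_UN_disjoint[symmetric, OF finCC])
      show "\<forall>S\<in>C. finite (edges (induce G (t S)))"
        using finite_edges[OF gr[OF G(1)]] by (simp add: edges_induce)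
      show "\<forall>S\<in>C. \<forall>S'\<in>C. S \<noteq> S' \<longrightarrow> edges (induce G (t S)) \<inter> edges (induce G (t S')) = {}"
      proof (intro ballI impI)
        fix S S' assume S: "S \<in> C" "S' \<in> C" "S \<noteq> S'"
        have False if "e \<in> edges (induce G (t S))" "e \<in> edges (induce G (t S'))" for e
        proof -
          have "e \<in> edges G" "e \<subseteq> t S \<inter> t S'" using that by (auto simp: edges_induce)
          then show False using disj[OF S] edgeE[OF gr[OF G(1)], of e] by auto
        qed
        then show "edges (induce G (t S)) \<inter> edges (induce G (t S')) = {}" by blast
      qed
    qed
    also have "\<dots> \<le> card (edges (induce G W))"
      using eW W(1) by (intro card_mono) (auto simp: edges_induce)
    finally have "real (n div s * (s - 1)) \<le> real (card (edges (induce G W)))" by (simp only: of_nat_le_iff)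
    moreover have "a * real n - c \<le> real (n div s * (s - 1))"
    proof -
      have "real n = real (n div s) * real s + real (n mod s)"
        by (metis div_mult_mod_eq of_nat_add of_nat_mult)
      then have "a * real n = real (n div s) * (a * real s) + a * real (n mod s)"
        by (simp add: algebra_simps)
      also have "a * real s = real (s - 1)" unfolding a_def using s1 by (simp add: field_simps of_nat_diff)
      also have "a * real (n mod s) \<le> 1 * real s"
        using a s1 by (intro mult_mono) (auto simp: less_imp_le)
      finally have "a * real n \<le> real (n div s) * real (s - 1) + real s" by simp
      moreover have "real s \<le> c" unfolding c_def by simp
      ultimately show ?thesis by simp
    qed
    ultimately have "a * real n - c \<le> real (card (edges (induce G W)))" by linarith
    moreover have "induce G W \<in> \<G>" by (rule induce_in_class[OF mc G(1) W(2)])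
    moreover have "card (verts (induce G W)) = n" using W(3) by (simp add: induce_def)
    ultimately show "\<exists>G\<in>\<G>. card (verts G) = n \<and> a * real n - c \<le> real (card (edges G))" by blast
  qed
  moreover have "a < 1" unfolding a_def using s1 by simp
  ultimately show ?thesis by (simp add: one_ereal_def)
qed

lemma not_C_less_1_contains:
  assumes mc: "minor_closed_class \<G>" and pr: "proper_class \<G>" and n: "\<G> \<notin> C_less_1"
  shows "class_G1 \<subseteq> \<G> \<or> class_G2 \<subseteq> \<G> \<or> class_G3 \<subseteq> \<G>"
proof (rule ccontr)
  assume c: "\<not> ?thesis"
  obtain k where k: "copies k (complete_graph 3) \<notin> \<G>"
    using c minors_of_subset[OF mc, of "\<lambda>k. copies k (complete_graph 3)"] unfolding class_G1_def by blast
  obtain D where D: "complete_bipartite 1 D \<notin> \<G>"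
    using c minors_of_subset[OF mc, of "complete_bipartite 1"] unfolding class_G2_def by blast
  obtain p where p: "path_graph p \<notin> \<G>"
    using c minors_of_subset[OF mc, of path_graph] unfolding class_G3_def by blast
  have "limiting_density \<G> < 1"
  proof (cases "finite (\<G> // graph_iso)")
    case True
    then show ?thesis unfolding limiting_density_def by simp
  next
    case False
    then show ?thesis using limiting_density_omitting[OF mc _ k D p] by blast
  qed
  then show False using mc pr n unfolding C_less_1_def by blast
qed

text \<open>The rest is order theory: every proper minor-closed class outside
  \<open>C_less_1\<close> contains one of three pairwise incomparable classes that are themselves
  outside, so these three are exactly the minimal ones.\<close>

theorem theorem3p3: "cobs C_less_1 = {class_G1, class_G2, class_G3}"
proof -
  let ?O = "{class_G1, class_G2, class_G3}"
  have O: "minor_closed_class \<H> \<and> proper_class \<H> \<and> \<H> \<notin> C_less_1" if "\<H> \<in> ?O" for \<H>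
    using that minor_closed_G1 minor_closed_G2 minor_closed_G3 proper_G1 proper_G2 proper_G3
      limiting_density_G1 limiting_density_G2 limiting_density_G3
    unfolding C_less_1_def by auto
  have sub: "\<exists>\<O>\<in>?O. \<O> \<subseteq> \<H>" if "minor_closed_class \<H>" "proper_class \<H>" "\<H> \<notin> C_less_1" for \<H>
    using not_C_less_1_contains[OF that] by blast
  have "\<not> class_G1 \<subseteq> class_G2" "\<not> class_G1 \<subseteq> class_G3" "\<not> class_G2 \<subseteq> class_G1"
    "\<not> class_G2 \<subseteq> class_G3" "\<not> class_G3 \<subseteq> class_G1" "\<not> class_G3 \<subseteq> class_G2"
    using triangles_in_G1[of 1] star_in_G2[of 3] path_in_G3[of 4] triangle_not_G2 triangle_not_G3
      star_not_G1 star_not_G3 path_not_G1 path_not_G2 by auto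
  then have anti: "\<O> = \<O>'" if "\<O> \<in> ?O" "\<O>' \<in> ?O" "\<O> \<subseteq> \<O>'" for \<O> \<O>'
    using that by blast
  show ?thesis
  proof (intro equalityI subsetI)
    fix \<H> assume H: "\<H> \<in> cobs C_less_1"
    then have H': "minor_closed_class \<H>" "proper_class \<H>" "\<H> \<notin> C_less_1"
      and least: "\<And>\<O>. minor_closed_class \<O> \<and> proper_class \<O> \<and> \<O> \<notin> C_less_1 \<Longrightarrow> \<O> \<subseteq> \<H> \<Longrightarrow> \<O> = \<H>"
      unfolding cobs_def by simp_all
    obtain \<O> where o: "\<O> \<in> ?O" "\<O> \<subseteq> \<H>" using sub[OF H'] by blast
    then have "\<O> = \<H>" using least[OF O] by blast
    with o(1) show "\<H> \<in> ?O" by simp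
  next
    fix \<O> assume o: "\<O> \<in> ?O"
    have "\<H> = \<O>" if H: "minor_closed_class \<H>" "proper_class \<H>" "\<H> \<notin> C_less_1" "\<H> \<subseteq> \<O>" for \<H>
    proof -
      obtain \<O>' where o': "\<O>' \<in> ?O" "\<O>' \<subseteq> \<H>" using sub[OF H(1-3)] by blast
      then have "\<O>' = \<O>" using anti[OF o'(1) o] H(4) by blast
      then show ?thesis using o' H(4) by blast
    qed
    then show "\<O> \<in> cobs C_less_1" using O[OF o] unfolding cobs_def by blast
  qed
qed

end
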